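(* Let $f_i:\mathbb{R}^n\to\mathbb{R}$, $i=1,\dots,N$, be continuously differentiable with globally Lipschitz gradients $\nabla f_i$ (the $f_i$ need not be convex), and suppose $F(w)=\frac1N\sum_{i=1}^N f_i(w)$ is strongly convex with parameter $\alpha>0$; let $w^*$ be its minimizer. Let $N$ agents communicate over an undirected connected graph, where $\mathcal{N}_i$ is the set of neighbors of agent $i$, and consider, with $w_i,z_i,\xi_i\in\mathbb{R}^n$ and arbitrary initial conditions, for $i=1,\dots,N$, $$\dot w_i=z_i+k_{\mathrm P}\sum_{j\in\mathcal{N}_i}(w_j-w_i)+k_{\mathrm I}\sum_{j\in\mathcal{N}_i}(\xi_j-\xi_i),\qquad \dot z_i=-2\sqrt{\alpha}\,z_i-\nabla f_i(w_i),\qquad \dot\xi_i=-k_{\mathrm I}\sum_{j\in\mathcal{N}_i}(w_j-w_i).$$ Then, for every $k_{\mathrm I}>0$ and all sufficiently large $k_{\mathrm P}$ (depending on $k_{\mathrm I}$), $w_i(t)\to w^*$ and $z_i(t)\to-\nabla f_i(w^* )/(2\sqrt{\alpha})$ as $t\to\infty$ for all $i$. Moreover, the convergence rate of the algorithm can be made arbitrarily close to $\sqrt{\alpha}/2$ with $k_{\mathrm P}=k_{\mathrm I}^{3/2}$ and sufficiently large $k_{\mathrm I}$; that is, for every $\upsilon\in(0,\sqrt{\alpha}/2)$ there is $\bar k>0$ such that, for all $k_{\mathrm I}>\bar k$ and $k_{\mathrm P}=k_{\mathrm I}^{3/2}$, every $[w_i(t);z_i(t)]$ converges to $[w^*;-\nabla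 f_i(w^* )/(2\sqrt{\alpha})]$ exponentially fast at least with the rate $\sqrt{\alpha}/2-\upsilon$.
   Context: $[a;b]$ denotes vertical stacking. $F:\mathbb{R}^n\to\mathbb{R}$ is strongly convex with parameter $\alpha$ if $(\nabla F(w)-\nabla F(w_0))^\top(w-w_0)\ge\alpha|w-w_0|^2$ for all $w,w_0$, where $|\cdot|$ is the Euclidean norm. A function $p(t)$ converges to $p^*$ exponentially fast at least with the rate $r>0$ if there is a constant $C$ with $|p(t)-p^*|\le Ce^{-rt}$ for all $t\ge0$. *)

theory Defs
  imports "HOL-Analysis.Analysis"
begin

definition gradient :: "('a::real_inner \<Rightarrow> real) \<Rightarrow> 'a \<Rightarrow> 'a" where
  "gradient f x = (THE D. GDERIV f x :> D)"

definition continuously_differentiable :: "('a::real_inner \<Rightarrow> real) \<Rightarrow> bool" where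
  "continuously_differentiable f \<longleftrightarrow>
     (\<forall>x. f differentiable (at x)) \<and> continuous_on UNIV (gradient f)"

definition strongly_convex :: "real \<Rightarrow> ('a::real_inner \<Rightarrow> real) \<Rightarrow> bool" where
  "strongly_convex \<alpha> F \<longleftrightarrow>
     (\<forall>w. F differentiable (at w)) \<and>
     (\<forall>w w0. (gradient F w - gradient F w0) \<bullet> (w - w0) \<ge> \<alpha> * (norm (w - w0))\<^sup>2)"

definition average :: "('m::finite \<Rightarrow> 'a \<Rightarrow> real) \<Rightarrow> 'a \<Rightarrow> real" where
  "average f w = (1 / real CARD('m)) * (\<Sum>i\<in>UNIV. f i w)"

definition converges_exponentially ::
    "(real \<Rightarrow> 'a::real_normed_vector) \<Rightarrow> 'a \<Rightarrow> real \<Rightarrow> bool" where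
  "converges_exponentially p p_lim r \<longleftrightarrow>
     r > 0 \<and> (\<exists>C. \<forall>t\<ge>0. norm (p t - p_lim) \<le> C * exp (- r * t))"

definition neighbours :: "('m \<times> 'm) set \<Rightarrow> 'm \<Rightarrow> 'm set" where
  "neighbours E i = {j. (i, j) \<in> E}"

text \<open>
  Solutions live on the time interval from 0 to infinity; the derivative at time 0 is one-sided.
  No initial values are prescribed.
\<close>

definition is_solution ::
    "('m::finite \<times> 'm) set \<Rightarrow> ('m \<Rightarrow> 'a::real_inner \<Rightarrow> real) \<Rightarrow> real \<Rightarrow> real \<Rightarrow> real \<Rightarrow>
     (real \<Rightarrow> 'm \<Rightarrow> 'a) \<Rightarrow> (real \<Rightarrow> 'm \<Rightarrow> 'a) \<Rightarrow> (real \<Rightarrow> 'm \<Rightarrow> 'a) \<Rightarrow> bool" where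
  "is_solution E f \<alpha> kP kI w z \<xi> \<longleftrightarrow>
     (\<forall>i. \<forall>t\<ge>0.
        ((\<lambda>s. w s i) has_vector_derivative
           (z t i + kP *\<^sub>R (\<Sum>j\<in>neighbours E i. w t j - w t i)
                  + kI *\<^sub>R (\<Sum>j\<in>neighbours E i. \<xi> t j - \<xi> t i))) (at t within {0..}) \<and>
        ((\<lambda>s. z s i) has_vector_derivative
           (- (2 * sqrt \<alpha>) *\<^sub>R z t i - gradient (f i) (w t i))) (at t within {0..}) \<and>
        ((\<lambda>s. \<xi> s i) has_vector_derivative
           (- kI *\<^sub>R (\<Sum>j\<in>neighbours E i. w t j - w t i))) (at t within {0..}))"

end

theory Submission
  imports Defs
begin

text \<open>
  Stack the states of all agents into vectors \<open>W\<close>, \<open>Z\<close>, \<open>\<Xi>\<close> and split each into its mean and its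
  deviation from consensus. The coupling terms are graph Laplacians and have mean zero, so the means
  follow the heavy ball equation for the average objective with damping \<open>2 sqrt \<alpha>\<close>, perturbed by an
  error that is Lipschitz in the disagreement. For a strongly convex objective, the energy of the heavy
  ball decays at rate \<open>sqrt \<alpha>\<close> (\<open>heavy_ball_dissipation\<close>), and the state, being the square root of
  an energy, at half that rate.

  The disagreement is damped by the proportional coupling, in the amount \<open>kP\<close> times the spectral gap
  of the Laplacian (\<open>spectral_gap\<close>). The integral coupling removes the constant bias caused by the
  gradients of the individual objectives at the common minimizer, which do not vanish one by one. It acts at the
  rate \<open>kI\<^sup>2 / kP\<close>, visible after the change of variables in \<open>disagreement_dissipation\<close>.
  The deviation of \<open>Z\<close> is driven both by the disagreement and by the averaged motion, with gains that
  are not small; but \<open>Z\<close> is itself damped and acts on the disagreement with a gain of order \<open>1 / kP\<close>,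
  which is small enough for a weighted sum of the four energies to decay (\<open>U_dissipation\<close>).

  The rate obtained is the smaller of \<open>sqrt \<alpha> / 2 - \<upsilon>\<close> and a multiple of \<open>kI\<^sup>2 / kP\<close>, valid
  once \<open>kP\<close> and \<open>kP / kI\<close> are large. With \<open>kI\<close> fixed it is positive. With \<open>kP = kI powr (3/2)\<close>, the
  ratio \<open>kP / kI\<close> and the integral rate \<open>kI\<^sup>2 / kP\<close> both equal \<open>sqrt kI\<close>, so both demands are
  met for large \<open>kI\<close>.
\<close>

section \<open>Gradients and strong convexity\<close>

lemma gradient_eq:
  assumes "GDERIV f x :> D"
  shows "gradient f x = D"
  unfolding gradient_def
proof (rule the_equality[where P = "\<lambda>D. GDERIV f x :> D", OF assms])
  fix D' assume "GDERIV f x :> D'"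
  with assms have "(\<lambda>h. h \<bullet> D) = (\<lambda>h. h \<bullet> D')"
    unfolding gderiv_def by (rule has_derivative_unique)
  then have "h \<bullet> D = h \<bullet> D'" for h by metis
  then show "D' = D" by (metis vector_eq_ldot)
qed

lemma GDERIV_gradient:
  fixes f :: "'a::euclidean_space \<Rightarrow> real"
  assumes "f differentiable (at x)"
  shows "GDERIV f x :> gradient f x"
proof -
  obtain f' where f': "(f has_derivative f') (at x)"
    using assms unfolding differentiable_def by blast
  then interpret linear f' by (rule has_derivative_linear)
  have "f' h = h \<bullet> (\<Sum>b\<in>Basis. f' b *\<^sub>R b)" for h
  proof -
    have "f' h = f' (\<Sum>b\<in>Basis. (h \<bullet> b) *\<^sub>R b)" by (simp add: euclidean_representation)
    also have "\<dots> = (\<Sum>b\<in>Basis. (h \<bullet> b) * f' b)" by (simp add: sum scale)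
    also have "\<dots> = h \<bullet> (\<Sum>b\<in>Basis. f' b *\<^sub>R b)"
      by (simp add: inner_sum_right mult.commute)
    finally show ?thesis .
  qed
  then have "f' = (\<lambda>h. h \<bullet> (\<Sum>b\<in>Basis. f' b *\<^sub>R b))" by blast
  with f' have "GDERIV f x :> (\<Sum>b\<in>Basis. f' b *\<^sub>R b)"
    unfolding gderiv_def by metis
  then show ?thesis using gradient_eq by metis
qed

lemma has_real_derivative_along_curve:
  fixes F :: "'a::euclidean_space \<Rightarrow> real"
  assumes "F differentiable (at (u t))"
    and "(u has_vector_derivative u') (at t within S)"
  shows "((\<lambda>s. F (u s)) has_real_derivative u' \<bullet> gradient F (u t)) (at t within S)"
proof -
  have "(F has_derivative (\<lambda>h. h \<bullet> gradient F (u t))) (at (u t))"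
    using GDERIV_gradient[OF assms(1)] unfolding gderiv_def .
  from has_derivative_compose[OF assms(2)[unfolded has_vector_derivative_def] this]
  show ?thesis by (simp add: has_field_derivative_def mult_commute_abs)
qed

text \<open>
  Along the segment from \<open>x\<close> to \<open>y\<close>, subtracting from \<open>F\<close> both its tangent at \<open>x\<close> and the
  quadratic \<open>\<alpha> / 2 * norm (_ - x)\<^sup>2\<close> leaves a function whose derivative is nonnegative: this is
  exactly the strong monotonicity of the gradient, divided by the parameter \<open>s\<close> of the segment.
\<close>
lemma strongly_convex_tangent_bound:
  fixes F :: "'a::euclidean_space \<Rightarrow> real"
  assumes "strongly_convex \<alpha> F"
  shows "F x + gradient F x \<bullet> (y - x) + \<alpha> / 2 * (norm (y - x))\<^sup>2 \<le> F y"
proof -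
  define d where "d = y - x"
  define \<phi> where "\<phi> s = F (x + s *\<^sub>R d) - s * (gradient F x \<bullet> d) - \<alpha> / 2 * s\<^sup>2 * (norm d)\<^sup>2" for s
  have diff: "F differentiable (at w)" for w
    using assms unfolding strongly_convex_def by blast
  have "\<phi> 0 \<le> \<phi> 1"
  proof (rule DERIV_nonneg_imp_nondecreasing, simp)
    fix s :: real assume s: "0 \<le> s" "s \<le> 1"
    have line: "((\<lambda>s. x + s *\<^sub>R d) has_vector_derivative d) (at s)"
      by (auto intro!: derivative_eq_intros)
    have "(\<phi> has_real_derivative
        (d \<bullet> gradient F (x + s *\<^sub>R d) - gradient F x \<bullet> d - \<alpha> * s * (norm d)\<^sup>2)) (at s)"
      unfolding \<phi>_def
      by (rule derivative_eq_intros has_real_derivative_along_curve[where u = "\<lambda>s. x + s *\<^sub>R d", OF diff line] refl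
          | simp)+
    moreover have "0 \<le> d \<bullet> gradient F (x + s *\<^sub>R d) - gradient F x \<bullet> d - \<alpha> * s * (norm d)\<^sup>2"
    proof (cases "s = 0")
      case False
      then have "s > 0" using s by simp
      have "\<alpha> * (norm (s *\<^sub>R d))\<^sup>2 \<le> (gradient F (x + s *\<^sub>R d) - gradient F x) \<bullet> (s *\<^sub>R d)"
        using assms unfolding strongly_convex_def
        by (metis add_diff_cancel_left')
      then have "s * (\<alpha> * s * (norm d)\<^sup>2)
          \<le> s * (d \<bullet> gradient F (x + s *\<^sub>R d) - gradient F x \<bullet> d)"
        by (simp add: power2_eq_square algebra_simps inner_commute)
      then show ?thesis using \<open>s > 0\<close> by (simp add: mult_le_cancel_left_pos)
    qed (simp add: inner_commute)
    ultimately show "\<exists>y. DERIV \<phi> s :> y \<and> 0 \<le> y" by blast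
  qed
  then show ?thesis unfolding \<phi>_def d_def by simp
qed

lemma gradient_at_minimum_eq_0:
  fixes F :: "'a::euclidean_space \<Rightarrow> real"
  assumes "F differentiable (at x)" "is_arg_min F (\<lambda>_. True) x"
  shows "gradient F x = 0"
proof -
  have "(\<lambda>h. h \<bullet> gradient F x) = (\<lambda>h. 0)"
  proof (rule differential_zero_maxmin[where S = UNIV and x = x and f = F])
    show "(F has_derivative (\<lambda>h. h \<bullet> gradient F x)) (at x)"
      using GDERIV_gradient[OF assms(1)] unfolding gderiv_def .
    show "(\<forall>y\<in>UNIV. F y \<le> F x) \<or> (\<forall>y\<in>UNIV. F x \<le> F y)"
      using assms(2) by (auto simp: is_arg_min_def not_less)
  qed auto
  then have "gradient F x \<bullet> gradient F x = 0" by meson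
  then show ?thesis by simp
qed

section \<open>The graph Laplacian\<close>

definition laplacian :: "('m::finite \<times> 'm) set \<Rightarrow> 'a::real_vector ^ 'm \<Rightarrow> 'a ^ 'm" where
  "laplacian E u = (\<chi> i. \<Sum>j\<in>neighbours E i. u $ i - u $ j)"

definition mean :: "'a::real_vector ^ 'm::finite \<Rightarrow> 'a" where
  "mean u = (1 / real CARD('m)) *\<^sub>R (\<Sum>i\<in>UNIV. u $ i)"

definition deviation :: "'a::real_vector ^ 'm::finite \<Rightarrow> 'a ^ 'm" where
  "deviation u = u - vec (mean u)"

lemma linear_laplacian: "linear (laplacian E)"
  by (rule linearI) (auto simp: laplacian_def vec_eq_iff scaleR_right.sum algebra_simps
      sum.distrib sum_subtractf intro!: sum.cong)

lemma linear_mean: "linear mean"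
  by (rule linearI) (auto simp: mean_def scaleR_right.sum algebra_simps sum.distrib)

lemma mean_vec [simp]: "mean (vec x :: 'a::real_vector ^ 'm::finite) = x"
  by (simp add: mean_def sum_constant_scaleR)

lemma linear_deviation: "linear deviation"
proof -
  have "linear (\<lambda>u. u - vec (mean u))"
    by (rule linear_compose_sub[OF linear_id[unfolded id_def]
          linear_compose[OF linear_mean linear_vec, unfolded o_def]])
  then show ?thesis unfolding deviation_def .
qed

lemma mean_deviation [simp]: "mean (deviation u) = 0"
  by (simp add: deviation_def linear_diff[OF linear_mean])

lemma laplacian_deviation [simp]: "laplacian E (deviation u) = laplacian E u"
  by (simp add: laplacian_def deviation_def)

lemma inner_eq_sum: "(u::'a::real_inner ^ 'm::finite) \<bullet> v = (\<Sum>i\<in>UNIV. u $ i \<bullet> v $ i)"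
  by (simp add: inner_vec_def)

lemma inner_vec_right:
  "(u::'a::real_inner ^ 'm::finite) \<bullet> vec x = real CARD('m) * (mean u \<bullet> x)"
  by (simp add: inner_eq_sum mean_def inner_sum_left)

lemma inner_deviation_right:
  fixes u :: "'a::real_inner ^ 'm::finite"
  assumes "mean u = 0"
  shows "u \<bullet> deviation g = u \<bullet> g"
  using assms by (simp add: deviation_def inner_diff_right inner_vec_right)

text \<open>
  Summation by parts on an undirected graph: every edge occurs in both orientations.
\<close>
lemma sum_neighbours_swap:
  fixes g :: "'m::finite \<Rightarrow> 'm \<Rightarrow> 'b::comm_monoid_add"
  assumes "sym E"
  shows "(\<Sum>i\<in>UNIV. \<Sum>j\<in>neighbours E i. g i j) = (\<Sum>i\<in>UNIV. \<Sum>j\<in>neighbours E i. g j i)"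
proof -
  have "(\<Sum>i\<in>UNIV. \<Sum>j\<in>neighbours E i. g i j) = (\<Sum>i\<in>UNIV. \<Sum>j\<in>UNIV. if (i, j) \<in> E then g i j else 0)"
    by (simp add: neighbours_def sum.If_cases)
  also have "\<dots> = (\<Sum>j\<in>UNIV. \<Sum>i\<in>UNIV. if (i, j) \<in> E then g i j else 0)"
    by (rule sum.swap)
  also have "\<dots> = (\<Sum>j\<in>UNIV. \<Sum>i\<in>UNIV. if (j, i) \<in> E then g i j else 0)"
    using assms by (intro sum.cong) (auto dest: symD)
  also have "\<dots> = (\<Sum>i\<in>UNIV. \<Sum>j\<in>neighbours E i. g j i)"
    by (simp add: neighbours_def sum.If_cases)
  finally show ?thesis .
qed

lemma mean_laplacian [simp]:
  fixes u :: "'a::real_vector ^ 'm::finite"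
  assumes "sym E"
  shows "mean (laplacian E u) = 0"
  using sum_neighbours_swap[OF assms, of "\<lambda>i j. u $ i"]
  by (simp add: mean_def laplacian_def sum_subtractf)

lemma deviation_laplacian [simp]:
  "sym E \<Longrightarrow> deviation (laplacian E u) = laplacian E u"
  by (simp add: deviation_def linear_0[OF linear_vec])

lemma inner_laplacian:
  fixes u :: "'a::real_inner ^ 'm::finite"
  assumes "sym E"
  shows "u \<bullet> laplacian E u = (\<Sum>i\<in>UNIV. \<Sum>j\<in>neighbours E i. (norm (u $ i - u $ j))\<^sup>2) / 2"
proof -
  have "u \<bullet> laplacian E u = (\<Sum>i\<in>UNIV. \<Sum>j\<in>neighbours E i. u $ i \<bullet> (u $ i - u $ j))"
    by (simp add: inner_eq_sum laplacian_def inner_sum_right)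
  moreover have "\<dots> = (\<Sum>i\<in>UNIV. \<Sum>j\<in>neighbours E i. u $ j \<bullet> (u $ j - u $ i))"
    by (rule sum_neighbours_swap[OF assms])
  ultimately have "2 * (u \<bullet> laplacian E u)
      = (\<Sum>i\<in>UNIV. \<Sum>j\<in>neighbours E i. u $ i \<bullet> (u $ i - u $ j) + u $ j \<bullet> (u $ j - u $ i))"
    by (simp add: sum.distrib)
  also have "\<dots> = (\<Sum>i\<in>UNIV. \<Sum>j\<in>neighbours E i. (norm (u $ i - u $ j))\<^sup>2)"
    by (intro sum.cong refl)
      (simp add: power2_norm_eq_inner inner_diff_left inner_diff_right inner_commute)
  finally show ?thesis by simp
qed

lemma laplacian_form_nonneg:
  "sym E \<Longrightarrow> 0 \<le> (u::'a::real_inner ^ 'm::finite) \<bullet> laplacian E u"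
  by (simp add: inner_laplacian sum_nonneg)

text \<open>
  A vanishing Dirichlet form makes \<open>u\<close> agree across every edge, and connectedness propagates
  this agreement to all agents.
\<close>
lemma laplacian_form_eq_0_imp_consensus:
  fixes u :: "'a::real_inner ^ 'm::finite"
  assumes "sym E" "E\<^sup>* = UNIV" "u \<bullet> laplacian E u = 0"
  shows "u = vec (mean u)"
proof -
  have "(\<Sum>j\<in>neighbours E i. (norm (u $ i - u $ j))\<^sup>2) = 0" for i
    using assms(3) unfolding inner_laplacian[OF assms(1)]
    by (simp add: sum_nonneg_eq_0_iff sum_nonneg)
  then have edge: "u $ i = u $ j" if "(i, j) \<in> E" for i j
    using that by (simp add: sum_nonneg_eq_0_iff neighbours_def)
  have const: "u $ i = u $ j" for i j
  proof -
    have "(i, j) \<in> E\<^sup>*" using assms(2) by simp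
    then show ?thesis by (induction rule: rtrancl_induct) (auto dest: edge)
  qed
  then have "u = vec (u $ undefined)" by (simp add: vec_eq_iff) 
  then show ?thesis by (metis mean_vec)
qed

text \<open>
  The algebraic connectivity of the graph, obtained as the minimum of the Dirichlet form on the
  unit sphere of the mean-zero subspace. Compactness gives the minimum, and it is positive because
  only consensus vectors annihilate the form.
\<close>
lemma spectral_gap:
  assumes "sym E" "E\<^sup>* = UNIV"
  shows "\<exists>\<nu>>0. \<forall>u :: 'a::euclidean_space ^ 'm::finite.
    mean u = 0 \<longrightarrow> \<nu> * (norm u)\<^sup>2 \<le> u \<bullet> laplacian E u"
proof -
  define S where "S = {u :: 'a ^ 'm. mean u = 0} \<inter> sphere 0 1"
  define \<phi> where "\<phi> u = u \<bullet> laplacian E u" for u :: "'a ^ 'm"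
  have "closed {u :: 'a ^ 'm. mean u = 0}"
    by (intro closed_Collect_eq linear_continuous_on continuous_on_const)
      (simp add: linear_mean flip: linear_conv_bounded_linear)
  then have "compact S" unfolding S_def by (simp add: closed_Int_compact)
  have cont: "continuous_on S \<phi>" unfolding \<phi>_def
    by (intro continuous_intros linear_continuous_on)
      (simp add: linear_laplacian flip: linear_conv_bounded_linear)
  obtain \<nu> where \<nu>: "\<nu> > 0" "\<And>u. u \<in> S \<Longrightarrow> \<nu> \<le> \<phi> u"
  proof (cases "S = {}")
    case False
    then obtain m where m: "m \<in> S" "\<And>u. u \<in> S \<Longrightarrow> \<phi> m \<le> \<phi> u"
      using continuous_attains_inf[OF \<open>compact S\<close> False cont] by auto
    have "\<phi> m \<noteq> 0"
    proof
      assume "\<phi> m = 0"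
      then have "m = vec (mean m)"
        using laplacian_form_eq_0_imp_consensus[OF assms, of m] unfolding \<phi>_def by simp
      with m(1) have "m = 0" by (simp add: S_def linear_0[OF linear_vec])
      with m(1) show False by (simp add: S_def)
    qed
    then have "\<phi> m > 0"
      using laplacian_form_nonneg[OF assms(1), of m] by (simp add: \<phi>_def)
    with m(2) that show ?thesis by blast
  qed (use that[of 1] in auto)
  show ?thesis
  proof (intro exI[of _ \<nu>] conjI allI impI \<nu>(1))
    fix u :: "'a ^ 'm" assume u: "mean u = 0"
    show "\<nu> * (norm u)\<^sup>2 \<le> u \<bullet> laplacian E u"
    proof (cases "u = 0")
      case False
      define e where "e = (1 / norm u) *\<^sub>R u"
      have "e \<in> S" using u False by (simp add: S_def e_def linear_cmul[OF linear_mean])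
      then have "\<nu> \<le> e \<bullet> laplacian E e" using \<nu>(2) \<phi>_def by simp
      also have "\<dots> = (u \<bullet> laplacian E u) / (norm u)\<^sup>2"
        by (simp add: e_def linear_cmul[OF linear_laplacian] power2_eq_square)
      finally show ?thesis using False by (simp add: field_simps)
    qed simp
  qed
qed

text \<open>
  Adding the projection onto consensus turns the Laplacian into an injective endomorphism of a
  finite-dimensional space, hence a surjective one; on mean-zero data the added term vanishes.
  This yields the rest value of the integral states \<open>\<xi>\<close>.
\<close>
lemma laplacian_solvable:
  fixes z :: "'a::euclidean_space ^ 'm::finite"
  assumes "sym E" "E\<^sup>* = UNIV" "mean z = 0"
  obtains c where "laplacian E c = z" "mean c = 0"
proof -
  let ?T = "\<lambda>u. laplacian E u + vec (mean u) :: 'a ^ 'm"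
  have lin: "linear ?T"
    by (rule linear_compose_add[OF linear_laplacian
          linear_compose[OF linear_mean linear_vec, unfolded o_def]])
  have mean_T: "mean (?T u) = mean u" for u
    by (simp add: linear_add[OF linear_mean] assms(1))
  have "inj ?T"
  proof (subst linear_injective_0[OF lin], intro allI impI)
    fix u :: "'a ^ 'm" assume T: "?T u = 0"
    then have "mean u = 0" using mean_T[of u] by (simp add: linear_0[OF linear_mean])
    with T have "laplacian E u = 0" by (simp add: linear_0[OF linear_vec])
    then have "u = vec (mean u)"
      by (intro laplacian_form_eq_0_imp_consensus[OF assms(1,2)]) simp
    with \<open>mean u = 0\<close> show "u = 0" by (simp add: linear_0[OF linear_vec])
  qed
  then have "surj ?T" using linear_injective_imp_surjective[OF lin] by blast
  then obtain c where "z = ?T c" by (rule surjE)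
  then have c: "?T c = z" by (rule sym)
  have "mean c = 0" using mean_T[of c] assms(3) unfolding c by simp
  then have "laplacian E c = z" using c by (simp add: linear_0[OF linear_vec])
  with \<open>mean c = 0\<close> show ?thesis using that by blast
qed

section \<open>Vector-valued calculus\<close>

text \<open>
  Lets the family of agent equations be read as one differential equation for a stacked vector.
\<close>
lemma has_vector_derivative_vec_lambda:
  fixes u :: "real \<Rightarrow> 'm::finite \<Rightarrow> 'a::real_normed_vector"
  assumes "\<And>i. ((\<lambda>s. u s i) has_vector_derivative u' i) (at t within S)"
  shows "((\<lambda>s. \<chi> i. u s i) has_vector_derivative (\<chi> i. u' i)) (at t within S)"
  unfolding has_vector_derivative_def has_derivative_within
proof
  show "bounded_linear (\<lambda>x. x *\<^sub>R (\<chi> i. u' i))" by (rule bounded_linear_scaleR_left)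
  show "((\<lambda>y. (1 / norm (y - t)) *\<^sub>R ((\<chi> i. u y i) - ((\<chi> i. u t i) + (y - t) *\<^sub>R (\<chi> i. u' i))))
      \<longlongrightarrow> 0) (at t within S)"
  proof (rule vec_tendstoI)
    fix i
    have "((\<lambda>y. (1 / norm (y - t)) *\<^sub>R (u y i - (u t i + (y - t) *\<^sub>R u' i))) \<longlongrightarrow> 0) (at t within S)"
      using assms[of i] unfolding has_vector_derivative_def has_derivative_within by blast
    then show "((\<lambda>y. ((1 / norm (y - t)) *\<^sub>R
        ((\<chi> i. u y i) - ((\<chi> i. u t i) + (y - t) *\<^sub>R (\<chi> i. u' i)))) $ i) \<longlongrightarrow> 0 $ i) (at t within S)"
      by simp
  qed
qed

lemma has_real_derivative_norm_squared:
  fixes u :: "real \<Rightarrow> 'a::real_inner"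
  assumes "(u has_vector_derivative u') (at t within S)"
  shows "((\<lambda>s. (norm (u s))\<^sup>2) has_real_derivative 2 * (u t \<bullet> u')) (at t within S)"
  using has_derivative_inner[OF assms[unfolded has_vector_derivative_def]
      assms[unfolded has_vector_derivative_def]]
  by (simp add: power2_norm_eq_inner has_field_derivative_def inner_commute algebra_simps
      mult_commute_abs)

text \<open>
  The differential inequality says that \<open>exp (r * t) * U t\<close> is nonincreasing. Only one-sided
  differentiability at time \<open>0\<close> is available, so this is read off from the mean value theorem on
  the closed interval up to \<open>t\<close>.
\<close>
lemma exponential_decay:
  fixes U :: "real \<Rightarrow> real"
  assumes deriv: "\<And>t. t \<ge> 0 \<Longrightarrow> (U has_real_derivative U' t) (at t within {0..})"
    and decay: "\<And>t. t \<ge> 0 \<Longrightarrow> U' t \<le> - r * U t"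
    and "t \<ge> 0"
  shows "U t \<le> U 0 * exp (- r * t)"
proof -
  define g where "g s = exp (r * s) * U s" for s
  have g: "(g has_derivative (\<lambda>h. h * (exp (r * s) * (U' s + r * U s)))) (at s within {0..t})"
    if "0 \<le> s" for s
  proof -
    have "(U has_real_derivative U' s) (at s within {0..t})"
      using deriv[OF that] by (rule has_field_derivative_subset) auto
    then have "(g has_real_derivative exp (r * s) * (U' s + r * U s)) (at s within {0..t})"
      unfolding g_def by (auto intro!: derivative_eq_intros simp: algebra_simps)
    then show ?thesis by (simp add: has_field_derivative_def mult_commute_abs)
  qed
  obtain s where s: "s \<in> {0..t}" "g t - g 0 = (t - 0) * (exp (r * s) * (U' s + r * U s))"
    using mvt_very_simple[OF \<open>t \<ge> 0\<close> g] by auto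
  have neg: "exp (r * s) * (U' s + r * U s) \<le> 0"
    using decay[of s] s(1) by (simp add: mult_nonneg_nonpos)
  have "(t - 0) * (exp (r * s) * (U' s + r * U s)) \<le> 0"
    by (rule mult_nonneg_nonpos[OF _ neg]) (use \<open>t \<ge> 0\<close> in simp)
  with s(2) have "g t \<le> g 0" by simp
  have "U t = exp (- (r * t)) * g t"
    unfolding g_def by (simp add: exp_minus field_simps)
  also have "\<dots> \<le> exp (- (r * t)) * g 0"
    using \<open>g t \<le> g 0\<close> by (intro mult_left_mono) auto
  also have "\<dots> = U 0 * exp (- r * t)" by (simp add: g_def mult.commute)
  finally show ?thesis .
qed

section \<open>The dissipation estimates\<close>

lemma young_inequality:
  fixes x y c :: real
  assumes "c > 0"
  shows "2 * (x * y) \<le> c * x\<^sup>2 + y\<^sup>2 / c"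
proof -
  have "0 \<le> (c * x - y)\<^sup>2 / c" using assms by simp
  then show ?thesis using assms by (simp add: power2_eq_square field_simps)
qed

text \<open>
  The disagreement \<open>a\<close> and the integral error \<open>c\<close> obey \<open>a' = b - p L a - q L c\<close> and
  \<open>c' = q L a\<close>. The natural energy \<open>norm a ^ 2 + norm c ^ 2\<close> dissipates only in \<open>a\<close>. Replacing \<open>c\<close> by
  \<open>h = c + (q / p) a\<close> cancels the large term: \<open>h' = (q / p) (b - q L c)\<close>, which is damped
  at the rate \<open>q\<^sup>2 / p\<close> up to terms in \<open>a\<close> and \<open>b\<close>. The weight \<open>\<mu>\<close> makes the
  cross term that \<open>h\<close> contributes to the energy of \<open>a\<close> half of what the damping of \<open>h\<close> leaves over,
  and the bound on \<open>q / p\<close> keeps the terms in \<open>a\<close> below its damping by \<open>p\<close>. The input \<open>b\<close> enters only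
  with a factor \<open>1 / p\<close>; this small gain is what closes the feedback loop later.
\<close>
lemma disagreement_dissipation:
  fixes L :: "'b::real_inner \<Rightarrow> 'b" and p q \<nu> \<Lambda> :: real
  assumes "linear L" and pos: "p > 0" "q > 0" "\<nu> > 0" "\<nu> \<le> \<Lambda>"
    and gap: "\<nu> * (norm a)\<^sup>2 \<le> a \<bullet> L a" "\<nu> * (norm h)\<^sup>2 \<le> h \<bullet> L h"
    and bound: "\<And>u. norm (L u) \<le> \<Lambda> * norm u"
    and ratio: "8 * \<Lambda>\<^sup>2 * q\<^sup>2 \<le> \<nu>\<^sup>2 * p\<^sup>2"
    and h: "h = c + (q / p) *\<^sub>R a"
    and \<mu>: "\<mu> = \<nu>\<^sup>2 / (4 * \<Lambda>\<^sup>2)"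
  shows "2 * (h \<bullet> ((q / p) *\<^sub>R (b - q *\<^sub>R L c))) + \<mu> * (2 * (a \<bullet> (b - p *\<^sub>R L a - q *\<^sub>R L c)))
    \<le> - (q\<^sup>2 / p * \<nu> / 2) * (norm h)\<^sup>2 - (\<mu> * \<nu> * p / 2) * (norm a)\<^sup>2
        + (2 * (1 + \<mu>) / (\<nu> * p)) * (norm b)\<^sup>2"
proof -
  define s where "s = q / p"
  have s: "s > 0" "q = s * p" using pos by (auto simp: s_def)
  have "\<Lambda> > 0" "\<mu> > 0" using pos \<mu> by auto
  let ?A = "norm a" and ?B = "norm b" and ?H = "norm h"
  have "c = h - s *\<^sub>R a" by (simp add: h s_def)
  then have Lc: "L c = L h - s *\<^sub>R L a"
    by (simp add: linear_diff[OF \<open>linear L\<close>] linear_cmul[OF \<open>linear L\<close>])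
  have bilinear: "u \<bullet> L v \<le> \<Lambda> * (norm u * norm v)" for u v
  proof -
    have "u \<bullet> L v \<le> norm u * norm (L v)" by (rule norm_cauchy_schwarz)
    also have "\<dots> \<le> norm u * (\<Lambda> * norm v)" by (intro mult_left_mono bound norm_ge_zero)
    finally show ?thesis by (simp add: mult_ac)
  qed
  have neg: "- (a \<bullet> L h) \<le> \<Lambda> * (?A * ?H)"
    using bilinear[of "- a" h] by simp
  have "2 * (h \<bullet> (s *\<^sub>R (b - q *\<^sub>R L c)))
      = 2 * s * (h \<bullet> b) - 2 * s\<^sup>2 * p * (h \<bullet> L h) + 2 * s ^ 3 * p * (h \<bullet> L a)"
    by (simp add: Lc s(2) inner_diff_right power2_eq_square power3_eq_cube algebra_simps)
  also have "\<dots> \<le> 2 * s * (?H * ?B) - 2 * s\<^sup>2 * p * (\<nu> * ?H\<^sup>2) + 2 * s ^ 3 * p * (\<Lambda> * (?H * ?A))"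
    using s pos by (intro add_mono diff_mono mult_left_mono norm_cauchy_schwarz gap bilinear) auto
  finally have I: "2 * (h \<bullet> (s *\<^sub>R (b - q *\<^sub>R L c))) \<le> \<dots>" .
  have "2 * (a \<bullet> (b - p *\<^sub>R L a - q *\<^sub>R L c))
      = 2 * (a \<bullet> b) - 2 * p * (a \<bullet> L a) + 2 * s * p * (- (a \<bullet> L h)) + 2 * s\<^sup>2 * p * (a \<bullet> L a)"
    by (simp add: Lc s(2) inner_diff_right power2_eq_square algebra_simps)
  also have "\<dots> \<le> 2 * (?A * ?B) - 2 * p * (\<nu> * ?A\<^sup>2) + 2 * s * p * (\<Lambda> * (?A * ?H))
        + 2 * s\<^sup>2 * p * (\<Lambda> * (?A * ?A))"
    using s pos by (intro add_mono diff_mono mult_left_mono norm_cauchy_schwarz gap bilinear neg) auto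
  finally have II: "2 * (a \<bullet> (b - p *\<^sub>R L a - q *\<^sub>R L c)) \<le> \<dots>" .
  \<comment> \<open>Each cross term is split by Young's inequality between the two dampings and the input.\<close>
  have Y1: "2 * s * (?H * ?B) \<le> s\<^sup>2 * p * \<nu> / 2 * ?H\<^sup>2 + 2 / (\<nu> * p) * ?B\<^sup>2"
    using young_inequality[of "p * \<nu> / 2" "s * ?H" ?B] pos by (simp add: power_mult_distrib mult_ac)
  define Q where "Q = s ^ 4 * \<Lambda>\<^sup>2 / \<nu> * (p * ?A\<^sup>2)"
  have Y2: "2 * s ^ 3 * p * (\<Lambda> * (?H * ?A)) \<le> s\<^sup>2 * p * \<nu> / 2 * ?H\<^sup>2 + 2 * Q"
  proof -
    have "2 * ?H * (s * \<Lambda> * ?A) \<le> \<nu> / 2 * ?H\<^sup>2 + (s * \<Lambda> * ?A)\<^sup>2 / (\<nu> / 2)"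
      using young_inequality[of "\<nu> / 2" ?H "s * \<Lambda> * ?A"] pos by simp
    from mult_left_mono[OF this, of "s\<^sup>2 * p"] show ?thesis using s pos
      by (simp add: Q_def power2_eq_square power3_eq_cube power4_eq_xxxx algebra_simps)
  qed
  have Y3: "2 * (?A * ?B) \<le> p * \<nu> / 2 * ?A\<^sup>2 + 2 / (\<nu> * p) * ?B\<^sup>2"
    using young_inequality[of "p * \<nu> / 2" ?A ?B] pos by (simp add: mult_ac)
  have Y4: "2 * s * p * (\<Lambda> * (?A * ?H)) \<le> p * \<nu> / 2 * ?A\<^sup>2 + 2 * s\<^sup>2 * p * \<Lambda>\<^sup>2 / \<nu> * ?H\<^sup>2"
  proof -
    have "2 * ?A * (s * \<Lambda> * ?H) \<le> \<nu> / 2 * ?A\<^sup>2 + (s * \<Lambda> * ?H)\<^sup>2 / (\<nu> / 2)"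
      using young_inequality[of "\<nu> / 2" ?A "s * \<Lambda> * ?H"] pos by simp
    from mult_left_mono[OF this, of p] show ?thesis using pos
      by (simp add: power2_eq_square algebra_simps)
  qed
  have s2: "s\<^sup>2 \<le> \<nu>\<^sup>2 / (8 * \<Lambda>\<^sup>2)"
    using ratio pos \<open>\<Lambda> > 0\<close> by (simp add: s_def field_simps)
  have G1: "2 * s\<^sup>2 * \<Lambda> \<le> \<nu> / 4"
  proof -
    have "2 * s\<^sup>2 * \<Lambda> \<le> 2 * (\<nu>\<^sup>2 / (8 * \<Lambda>\<^sup>2)) * \<Lambda>" using s2 \<open>\<Lambda> > 0\<close> by (intro mult_right_mono mult_left_mono) auto
    also have "\<dots> = \<nu> / 4 * (\<nu> / \<Lambda>)" using \<open>\<Lambda> > 0\<close> by (simp add: power2_eq_square field_simps)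
    also have "\<dots> \<le> \<nu> / 4 * 1" using pos \<open>\<Lambda> > 0\<close> by (intro mult_left_mono) auto
    finally show ?thesis by simp
  qed
  have G2: "2 * s ^ 4 * \<Lambda>\<^sup>2 / \<nu> \<le> \<mu> * \<nu> / 4"
  proof -
    have "s ^ 4 = (s\<^sup>2)\<^sup>2" by simp
    also have "\<dots> \<le> (\<nu>\<^sup>2 / (8 * \<Lambda>\<^sup>2))\<^sup>2" using s2 by (intro power_mono) auto
    finally have "2 * s ^ 4 * \<Lambda>\<^sup>2 / \<nu> \<le> 2 * (\<nu>\<^sup>2 / (8 * \<Lambda>\<^sup>2))\<^sup>2 * \<Lambda>\<^sup>2 / \<nu>"
      using pos by (intro divide_right_mono mult_right_mono mult_left_mono) auto
    also have "\<dots> = \<mu> * \<nu> / 8" unfolding \<mu> using pos \<open>\<Lambda> > 0\<close>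
      by (simp add: power2_eq_square field_simps)
    also have "\<dots> \<le> \<mu> * \<nu> / 4" using pos \<open>\<mu> > 0\<close> by simp
    finally show ?thesis .
  qed
  have G3: "\<mu> * (2 * s\<^sup>2 * p * \<Lambda>\<^sup>2 / \<nu>) = s\<^sup>2 * p * \<nu> / 2"
    unfolding \<mu> using pos \<open>\<Lambda> > 0\<close> by (simp add: power2_eq_square field_simps)
  have "\<mu> * (2 * (a \<bullet> (b - p *\<^sub>R L a - q *\<^sub>R L c)))
      \<le> \<mu> * ((p * \<nu> / 2 * ?A\<^sup>2 + 2 / (\<nu> * p) * ?B\<^sup>2) - 2 * p * (\<nu> * ?A\<^sup>2)
          + (p * \<nu> / 2 * ?A\<^sup>2 + 2 * s\<^sup>2 * p * \<Lambda>\<^sup>2 / \<nu> * ?H\<^sup>2) + 2 * s\<^sup>2 * p * (\<Lambda> * (?A * ?A)))"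
    by (rule mult_left_mono[OF _ less_imp_le[OF \<open>\<mu> > 0\<close>]]) (use II Y3 Y4 in linarith)
  also have "\<dots> = \<mu> * (2 / (\<nu> * p)) * ?B\<^sup>2 - \<mu> * p * \<nu> * ?A\<^sup>2 + s\<^sup>2 * p * \<nu> / 2 * ?H\<^sup>2
          + \<mu> * p * ?A\<^sup>2 * (2 * s\<^sup>2 * \<Lambda>)"
    unfolding G3[symmetric] by (simp add: power2_eq_square algebra_simps)
  also have "\<dots> \<le> \<mu> * (2 / (\<nu> * p)) * ?B\<^sup>2 - \<mu> * p * \<nu> * ?A\<^sup>2 + s\<^sup>2 * p * \<nu> / 2 * ?H\<^sup>2
          + \<mu> * p * ?A\<^sup>2 * (\<nu> / 4)"
    using G1 \<open>\<mu> > 0\<close> pos by (intro add_left_mono mult_left_mono) auto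
  finally have II': "\<mu> * (2 * (a \<bullet> (b - p *\<^sub>R L a - q *\<^sub>R L c))) \<le> \<dots>" .
  have "2 * s ^ 4 * \<Lambda>\<^sup>2 / \<nu> * (p * ?A\<^sup>2) \<le> \<mu> * \<nu> / 4 * (p * ?A\<^sup>2)"
    using G2 pos by (intro mult_right_mono) auto
  then have "2 * Q \<le> \<mu> * p * \<nu> / 4 * ?A\<^sup>2" by (simp add: Q_def mult_ac)
  then have "2 * (h \<bullet> (s *\<^sub>R (b - q *\<^sub>R L c))) + \<mu> * (2 * (a \<bullet> (b - p *\<^sub>R L a - q *\<^sub>R L c)))
      \<le> - (s\<^sup>2 * p * \<nu> / 2) * ?H\<^sup>2 - \<mu> * p * \<nu> / 2 * ?A\<^sup>2
        + (1 + \<mu>) * (2 / (\<nu> * p)) * ?B\<^sup>2"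
    using I Y1 Y2 II' by (simp add: algebra_simps add_divide_distrib)
  moreover have "q\<^sup>2 / p = s\<^sup>2 * p" using pos by (simp add: s_def power2_eq_square)
  ultimately show ?thesis unfolding s_def[symmetric] \<open>q\<^sup>2 / p = s\<^sup>2 * p\<close> by (simp add: mult_ac)
qed

text \<open>
  The heavy ball \<open>y'' + 2 sqrt \<alpha> y' + gradient F y = 0\<close> has the Lyapunov function
  \<open>V = F y - F w + norm (sqrt \<alpha> (y - w) + y') ^ 2 / 2\<close>, which decays at rate \<open>sqrt \<alpha>\<close>: in its
  derivative the terms \<open>y' \<bullet> gradient F y\<close> cancel, and the tangent bound turns what is left
  into a multiple of \<open>V\<close>. The perturbation \<open>e\<close> costs an arbitrarily small \<open>\<upsilon>\<close> of this rate.
\<close>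
lemma heavy_ball_dissipation:
  fixes F :: "'a::euclidean_space \<Rightarrow> real" and y :: 'a
  assumes sc: "strongly_convex \<alpha> F" and "is_arg_min F (\<lambda>_. True) w" and "\<alpha> > 0" "\<upsilon> > 0"
  defines "x \<equiv> y - w"
  shows "v \<bullet> gradient F y
      + (sqrt \<alpha> *\<^sub>R x + v) \<bullet> (sqrt \<alpha> *\<^sub>R v + (- (2 * sqrt \<alpha>) *\<^sub>R v - (gradient F y + e)))
    \<le> - (sqrt \<alpha> - \<upsilon>) * (F y - F w + (norm (sqrt \<alpha> *\<^sub>R x + v))\<^sup>2 / 2)
        + (norm e)\<^sup>2 / (2 * \<upsilon>)"
proof -
  define s where "s = sqrt \<alpha>"
  have s: "s > 0" "s\<^sup>2 = \<alpha>" using assms by (auto simp: s_def)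
  let ?D = "gradient F y" and ?y = "s *\<^sub>R x + v"
  have tangent: "F y - F w + \<alpha> / 2 * (norm x)\<^sup>2 \<le> x \<bullet> ?D"
  proof -
    have "F y + ?D \<bullet> (w - y) + \<alpha> / 2 * (norm (w - y))\<^sup>2 \<le> F w"
      by (rule strongly_convex_tangent_bound[OF sc])
    moreover have "?D \<bullet> (w - y) = - (x \<bullet> ?D)"
      by (simp add: x_def inner_diff_left inner_diff_right inner_commute)
    ultimately show ?thesis by (simp add: x_def norm_minus_commute)
  qed
  have min: "F w \<le> F y" using assms(2) by (auto simp: is_arg_min_def not_less)
  have "- (?y \<bullet> e) \<le> norm ?y * norm e"
    using Cauchy_Schwarz_ineq2[of ?y e] by linarith
  also have "\<dots> \<le> (\<upsilon> * (norm ?y)\<^sup>2 + (norm e)\<^sup>2 / \<upsilon>) / 2"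
    using young_inequality[OF \<open>\<upsilon> > 0\<close>, of "norm ?y" "norm e"] by simp
  finally have err: "- (?y \<bullet> e) \<le> \<upsilon> * ((norm ?y)\<^sup>2 / 2) + (norm e)\<^sup>2 / (2 * \<upsilon>)"
    by (simp add: add_divide_distrib mult.commute)
  have "v \<bullet> ?D + ?y \<bullet> (s *\<^sub>R v + (- (2 * s) *\<^sub>R v - (?D + e)))
      = - s * (s * (x \<bullet> v) + (norm v)\<^sup>2 + x \<bullet> ?D) - ?y \<bullet> e"
    by (simp add: power2_norm_eq_inner inner_add_left inner_add_right inner_diff_right algebra_simps)
  also have "\<dots> \<le> - s * (s * (x \<bullet> v) + (norm v)\<^sup>2 / 2 + (F y - F w + \<alpha> / 2 * (norm x)\<^sup>2)) - ?y \<bullet> e"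
  proof (intro diff_right_mono mult_left_mono_neg)
    show "s * (x \<bullet> v) + (norm v)\<^sup>2 / 2 + (F y - F w + \<alpha> / 2 * (norm x)\<^sup>2)
        \<le> s * (x \<bullet> v) + (norm v)\<^sup>2 + x \<bullet> ?D"
      using tangent zero_le_power2[of "norm v"] by linarith
  qed (use s in simp)
  also have "\<dots> = - s * (F y - F w + (norm ?y)\<^sup>2 / 2) - ?y \<bullet> e"
  proof -
    have "(norm ?y)\<^sup>2 = s * (s * (norm x)\<^sup>2) + 2 * s * (x \<bullet> v) + (norm v)\<^sup>2"
      unfolding power2_norm_eq_inner
      by (simp add: inner_add_left inner_add_right inner_commute algebra_simps)
    then show ?thesis
      unfolding s(2)[symmetric] by (simp add: power2_eq_square[of s] field_simps)
  qed
  also have "\<dots> \<le> - s * (F y - F w + (norm ?y)\<^sup>2 / 2)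
      + (\<upsilon> * (F y - F w) + \<upsilon> * ((norm ?y)\<^sup>2 / 2) + (norm e)\<^sup>2 / (2 * \<upsilon>))"
  proof -
    have "0 \<le> \<upsilon> * (F y - F w)" using min \<open>\<upsilon> > 0\<close> by simp
    then show ?thesis using err by linarith
  qed
  also have "\<dots> = - (s - \<upsilon>) * (F y - F w + (norm ?y)\<^sup>2 / 2) + (norm e)\<^sup>2 / (2 * \<upsilon>)"
    by (simp add: field_simps)
  finally show ?thesis unfolding s_def .
qed

section \<open>Trajectories of the algorithm\<close>

definition gradients ::
    "('m::finite \<Rightarrow> 'a::real_inner \<Rightarrow> real) \<Rightarrow> 'a ^ 'm \<Rightarrow> 'a ^ 'm" where
  "gradients f u = (\<chi> i. gradient (f i) (u $ i))"

lemma gradient_average: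
  fixes f :: "'m::finite \<Rightarrow> 'a::euclidean_space \<Rightarrow> real"
  assumes "\<And>i. f i differentiable (at x)"
  shows "gradient (average f) x = mean (gradients f (vec x))"
proof (rule gradient_eq)
  have "(f i has_derivative (\<lambda>h. h \<bullet> gradient (f i) x)) (at x)" for i
    using GDERIV_gradient[OF assms] unfolding gderiv_def .
  then have "(average f has_derivative
      (\<lambda>h. 1 / real CARD('m) * (\<Sum>i\<in>UNIV. h \<bullet> gradient (f i) x))) (at x)"
    unfolding average_def by (intro has_derivative_mult_right has_derivative_sum)
  then show "GDERIV (average f) x :> mean (gradients f (vec x))"
    by (simp add: gderiv_def mean_def gradients_def inner_sum_right)
qed

lemma lipschitz_gradients:
  fixes f :: "'m::finite \<Rightarrow> 'a::real_inner \<Rightarrow> real"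
  assumes "\<And>i. \<exists>L. L-lipschitz_on UNIV (gradient (f i))"
  shows "\<exists>l>0. \<forall>u v. norm (gradients f u - gradients f v) \<le> l * norm (u - v)"
proof -
  obtain L where L: "\<And>i. (L i)-lipschitz_on UNIV (gradient (f i))" using assms by metis
  define l where "l = 1 + (\<Sum>i\<in>UNIV. L i)"
  have L0: "0 \<le> L i" for i using L by (rule lipschitz_on_nonneg)
  then have "l > 0" unfolding l_def by (simp add: add_pos_nonneg sum_nonneg)
  have Ll: "L i \<le> l" for i
    using member_le_sum[of i UNIV L] L0 by (simp add: l_def)
  have "norm (gradients f u - gradients f v) \<le> l * norm (u - v)" for u v
  proof -
    have "norm (gradients f u - gradients f v) \<le> norm (l *\<^sub>R (u - v))"
    proof (rule norm_le_componentwise_cart)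
      fix i
      have "norm (gradient (f i) (u $ i) - gradient (f i) (v $ i)) \<le> L i * norm (u $ i - v $ i)"
        using lipschitz_onD[OF L[of i] UNIV_I UNIV_I, of "u $ i" "v $ i"] by (simp add: dist_norm)
      also have "\<dots> \<le> l * norm (u $ i - v $ i)" by (intro mult_right_mono Ll) simp
      finally show "norm ((gradients f u - gradients f v) $ i) \<le> norm ((l *\<^sub>R (u - v)) $ i)"
        using \<open>l > 0\<close> by (simp add: gradients_def)
    qed
    then show ?thesis using \<open>l > 0\<close> by simp
  qed
  with \<open>l > 0\<close> show ?thesis by blast
qed

lemma norm_squared_mean_deviation:
  fixes u :: "'a::real_inner ^ 'm::finite"
  shows "(norm u)\<^sup>2 = (norm (deviation u))\<^sup>2 + real CARD('m) * (norm (mean u))\<^sup>2"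
proof -
  have "u = deviation u + vec (mean u)" by (simp add: deviation_def)
  then have "u \<bullet> u = (deviation u + vec (mean u)) \<bullet> (deviation u + vec (mean u))" by simp
  also have "\<dots> = deviation u \<bullet> deviation u + 2 * (deviation u \<bullet> vec (mean u))
      + vec (mean u) \<bullet> (vec (mean u) :: 'a ^ 'm)"
    by (simp add: inner_add_left inner_add_right inner_commute)
  finally show ?thesis by (simp add: power2_norm_eq_inner inner_vec_right)
qed

lemma norm_mean_le: "norm (mean (u :: 'a::real_inner ^ 'm::finite)) \<le> norm u"
proof -
  have "1 * (norm (mean u))\<^sup>2 \<le> real CARD('m) * (norm (mean u))\<^sup>2"
    by (intro mult_right_mono) (auto simp: Suc_le_eq)
  then have "(norm (mean u))\<^sup>2 \<le> (norm u)\<^sup>2"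
    using zero_le_power2[of "norm (deviation u)"] norm_squared_mean_deviation[of u] by linarith
  then show ?thesis by (rule power2_le_imp_le) simp
qed

text \<open>
  One solution together with all constants that its Lyapunov analysis needs. Here \<open>\<nu>\<close> and \<open>\<Lambda>\<close>
  bound the Laplacian below on mean-zero vectors and above, \<open>l\<close> is a Lipschitz constant of the stacked
  gradients, \<open>\<upsilon>\<close> is the loss of rate to be tolerated, and \<open>\<mu>\<close>, \<open>\<beta>\<close> are the weights of the
  disagreement and of the drift of \<open>z\<close> in the Lyapunov function. The value of \<open>\<beta>\<close> makes the energy that
  the averaged motion feeds into that drift cost exactly another \<open>\<upsilon>\<close> of the rate. In \<open>large_p\<close>, the
  first condition makes the drift's influence on the disagreement harmless, the second lets
  the damping of the disagreement absorb its influence on everything else.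
\<close>
locale consensus_trajectory =
  fixes f :: "'m::finite \<Rightarrow> 'a::euclidean_space \<Rightarrow> real"
    and E :: "('m \<times> 'm) set"
    and \<alpha> \<nu> \<Lambda> l \<upsilon> \<mu> \<beta> p q :: real
    and w_opt :: 'a
    and w z \<xi> :: "real \<Rightarrow> 'm \<Rightarrow> 'a"
  assumes differentiable: "\<And>i x. f i differentiable (at x)"
    and strongly_convex: "strongly_convex \<alpha> (average f)"
    and minimizer: "is_arg_min (average f) (\<lambda>_. True) w_opt"
    and sym: "sym E" and connected: "E\<^sup>* = UNIV"
    and lipschitz: "\<And>u v. norm (gradients f u - gradients f v) \<le> l * norm (u - v)"
    and gap: "\<And>u :: 'a ^ 'm. mean u = 0 \<Longrightarrow> \<nu> * (norm u)\<^sup>2 \<le> u \<bullet> laplacian E u"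
    and bound: "\<And>u :: 'a ^ 'm. norm (laplacian E u) \<le> \<Lambda> * norm u"
    and pos: "\<alpha> > 0" "l > 0" "\<nu> > 0" "\<nu> \<le> \<Lambda>" "\<upsilon> > 0" "p > 0" "q > 0"
    and \<mu>: "\<mu> = \<nu>\<^sup>2 / (4 * \<Lambda>\<^sup>2)"
    and \<beta>: "\<beta> = \<upsilon> * \<alpha> * sqrt \<alpha> / (l\<^sup>2 * real CARD('m))"
    and ratio: "8 * \<Lambda>\<^sup>2 * q\<^sup>2 \<le> \<nu>\<^sup>2 * p\<^sup>2"
    and large_p: "2 * (1 + \<mu>) / (\<nu> * p) \<le> sqrt \<alpha> * \<beta>"
      "l\<^sup>2 / (2 * \<upsilon>) + \<beta> * l\<^sup>2 / (2 * sqrt \<alpha>) + sqrt \<alpha> * \<mu> \<le> \<mu> * \<nu> * p / 2"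
    and solution: "is_solution E f \<alpha> p q w z \<xi>"
begin

definition "W t = (\<chi> i. w t i)"
definition "Z t = (\<chi> i. z t i)"
definition "\<Xi> t = (\<chi> i. \<xi> t i)"
definition "z_opt = - (1 / (2 * sqrt \<alpha>)) *\<^sub>R gradients f (vec w_opt)"
text \<open>
  At rest the integral states are determined only up to a common constant, since their mean is a
  constant of the motion; normalising the mean to zero makes \<open>c\<close> and \<open>h\<close> mean-zero vectors, to
  which the spectral gap applies.
\<close>
definition "\<xi>_opt = (SOME c. laplacian E c = (1 / q) *\<^sub>R z_opt \<and> mean c = 0)"
definition "x t = mean (W t) - w_opt"
definition "v t = mean (Z t)"
definition "a t = deviation (W t)"
definition "b t = deviation (Z t) - z_opt"
definition "c t = deviation (\<Xi> t) - \<xi>_opt"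
definition "h t = c t + (q / p) *\<^sub>R a t"

abbreviation "F \<equiv> average f"

lemma \<mu>_pos: "\<mu> > 0" using pos \<mu> by simp
lemma \<beta>_pos: "\<beta> > 0" using pos \<beta> by simp

lemma F_differentiable: "F differentiable (at y)"
  using strongly_convex by (simp add: strongly_convex_def)

lemma mean_gradients_opt: "mean (gradients f (vec w_opt)) = 0"
  using gradient_at_minimum_eq_0[OF F_differentiable minimizer]
    gradient_average[of f w_opt, OF differentiable] by simp

text \<open>
  The rest values of the \<open>z\<close> sum to zero because \<open>w_opt\<close> is stationary for the average. They can
  therefore be balanced by the integral coupling, which reaches mean-zero vectors only.
\<close>
lemma mean_z_opt: "mean z_opt = 0"
  by (simp add: z_opt_def linear_cmul[OF linear_mean] linear_neg[OF linear_mean] mean_gradients_opt)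

lemma \<xi>_opt: "laplacian E \<xi>_opt = (1 / q) *\<^sub>R z_opt" "mean \<xi>_opt = 0"
proof -
  have "mean ((1 / q) *\<^sub>R z_opt) = 0" by (simp add: linear_cmul[OF linear_mean] mean_z_opt)
  from laplacian_solvable[OF sym connected this]
  have "\<exists>c. laplacian E c = (1 / q) *\<^sub>R z_opt \<and> mean c = 0" by metis
  from someI_ex[OF this]
  show "laplacian E \<xi>_opt = (1 / q) *\<^sub>R z_opt" "mean \<xi>_opt = 0"
    unfolding \<xi>_opt_def by auto
qed

lemma mean_eq_0: "mean (a t) = 0" "mean (b t) = 0" "mean (h t) = 0"
  by (simp_all add: a_def b_def c_def h_def linear_add[OF linear_mean] linear_diff[OF linear_mean]
      linear_cmul[OF linear_mean] mean_z_opt \<xi>_opt)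

lemma sum_neighbours_eq_laplacian:
  "(\<Sum>j\<in>neighbours E i. u j - u i) = - (laplacian E (\<chi> i. u i)) $ i" for u :: "'m \<Rightarrow> 'a"
  by (simp add: laplacian_def flip: sum_negf)

lemma derivative_W:
  assumes "t \<ge> 0"
  shows "(W has_vector_derivative (Z t - p *\<^sub>R laplacian E (W t) - q *\<^sub>R laplacian E (\<Xi> t)))
    (at t within {0..})"
proof -
  have "((\<lambda>s. \<chi> i. w s i) has_vector_derivative
      (\<chi> i. z t i + p *\<^sub>R (\<Sum>j\<in>neighbours E i. w t j - w t i)
        + q *\<^sub>R (\<Sum>j\<in>neighbours E i. \<xi> t j - \<xi> t i))) (at t within {0..})"
    using solution assms unfolding is_solution_def
    by (intro has_vector_derivative_vec_lambda) blast
  moreover have "(\<chi> i. z t i + p *\<^sub>R (\<Sum>j\<in>neighbours E i. w t j - w t i)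
        + q *\<^sub>R (\<Sum>j\<in>neighbours E i. \<xi> t j - \<xi> t i))
      = Z t - p *\<^sub>R laplacian E (W t) - q *\<^sub>R laplacian E (\<Xi> t)"
    by (simp add: vec_eq_iff sum_neighbours_eq_laplacian W_def Z_def \<Xi>_def)
  ultimately show ?thesis by (simp add: W_def[abs_def])
qed

lemma derivative_Z:
  assumes "t \<ge> 0"
  shows "(Z has_vector_derivative (- (2 * sqrt \<alpha>) *\<^sub>R Z t - gradients f (W t))) (at t within {0..})"
proof -
  have "((\<lambda>s. \<chi> i. z s i) has_vector_derivative
      (\<chi> i. - (2 * sqrt \<alpha>) *\<^sub>R z t i - gradient (f i) (w t i))) (at t within {0..})"
    using solution assms unfolding is_solution_def
    by (intro has_vector_derivative_vec_lambda) blast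
  moreover have "(\<chi> i. - (2 * sqrt \<alpha>) *\<^sub>R z t i - gradient (f i) (w t i))
      = - (2 * sqrt \<alpha>) *\<^sub>R Z t - gradients f (W t)"
    by (simp add: vec_eq_iff W_def Z_def gradients_def)
  ultimately show ?thesis by (simp add: Z_def[abs_def])
qed

lemma derivative_\<Xi>:
  assumes "t \<ge> 0"
  shows "(\<Xi> has_vector_derivative (q *\<^sub>R laplacian E (W t))) (at t within {0..})"
proof -
  have "((\<lambda>s. \<chi> i. \<xi> s i) has_vector_derivative
      (\<chi> i. - q *\<^sub>R (\<Sum>j\<in>neighbours E i. w t j - w t i))) (at t within {0..})"
    using solution assms unfolding is_solution_def
    by (intro has_vector_derivative_vec_lambda) blast
  moreover have "(\<chi> i. - q *\<^sub>R (\<Sum>j\<in>neighbours E i. w t j - w t i)) = q *\<^sub>R laplacian E (W t)"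
    by (simp add: vec_eq_iff sum_neighbours_eq_laplacian W_def)
  ultimately show ?thesis by (simp add: \<Xi>_def[abs_def])
qed

lemma has_vector_derivative_linear:
  fixes T :: "'a ^ 'm \<Rightarrow> 'b::real_normed_vector"
  assumes "linear T" "(u has_vector_derivative u') G"
  shows "((\<lambda>s. T (u s)) has_vector_derivative T u') G"
  using assms bounded_linear.has_vector_derivative linear_conv_bounded_linear by blast

lemmas linear_simps =
  linear_add[OF linear_deviation] linear_diff[OF linear_deviation]
  linear_cmul[OF linear_deviation] linear_neg[OF linear_deviation]
  linear_add[OF linear_mean] linear_diff[OF linear_mean]
  linear_cmul[OF linear_mean] linear_neg[OF linear_mean]
  linear_add[OF linear_laplacian] linear_diff[OF linear_laplacian]
  linear_cmul[OF linear_laplacian] linear_neg[OF linear_laplacian]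

text \<open>
  Coupling terms have mean zero, so the averages \<open>x\<close> and \<open>v\<close> form a heavy ball for the average
  objective, perturbed only by \<open>e\<close>, the effect of disagreement on the gradients.
\<close>
lemma derivative_x:
  assumes "t \<ge> 0"
  shows "(x has_vector_derivative v t) (at t within {0..})"
  unfolding x_def[abs_def] v_def
  using has_vector_derivative_linear[OF linear_mean derivative_W[OF assms]]
  by (auto intro!: derivative_eq_intros simp: linear_simps sym)

definition "e t = mean (gradients f (W t) - gradients f (vec (mean (W t))))"

lemma derivative_v:
  assumes "t \<ge> 0"
  shows "(v has_vector_derivative (- (2 * sqrt \<alpha>) *\<^sub>R v t - (gradient F (mean (W t)) + e t)))
    (at t within {0..})"
  unfolding v_def[abs_def]
  using has_vector_derivative_linear[OF linear_mean derivative_Z[OF assms]]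
  by (simp add: linear_simps e_def gradient_average[OF differentiable])

lemma derivative_a:
  assumes "t \<ge> 0"
  shows "(a has_vector_derivative (b t - p *\<^sub>R laplacian E (a t) - q *\<^sub>R laplacian E (c t)))
    (at t within {0..})"
  unfolding a_def[abs_def]
  using has_vector_derivative_linear[OF linear_deviation derivative_W[OF assms]] pos
  by (simp add: linear_simps sym b_def c_def \<xi>_opt algebra_simps)

definition "g t = gradients f (W t) - gradients f (vec w_opt)"

lemma derivative_b:
  assumes "t \<ge> 0"
  shows "(b has_vector_derivative (- (2 * sqrt \<alpha>) *\<^sub>R b t - deviation (g t))) (at t within {0..})"
proof -
  have "deviation z_opt = z_opt"
    by (simp add: deviation_def mean_z_opt linear_0[OF linear_vec])
  moreover have "gradients f (vec w_opt) = - (2 * sqrt \<alpha>) *\<^sub>R z_opt"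
    using pos by (simp add: z_opt_def)
  ultimately have "- (2 * sqrt \<alpha>) *\<^sub>R b t - deviation (g t)
      = deviation (- (2 * sqrt \<alpha>) *\<^sub>R Z t - gradients f (W t))"
    by (simp add: b_def g_def linear_simps algebra_simps)
  moreover have "(b has_vector_derivative deviation (- (2 * sqrt \<alpha>) *\<^sub>R Z t - gradients f (W t)))
      (at t within {0..})"
    unfolding b_def[abs_def]
    using has_vector_derivative_diff_const[THEN iffD2,
        OF has_vector_derivative_linear[OF linear_deviation derivative_Z[OF assms]]] .
  ultimately show ?thesis by metis
qed

lemma derivative_h:
  assumes "t \<ge> 0"
  shows "(h has_vector_derivative ((q / p) *\<^sub>R (b t - q *\<^sub>R laplacian E (c t)))) (at t within {0..})"
proof -
  have "(c has_vector_derivative deviation (q *\<^sub>R laplacian E (W t))) (at t within {0..})"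
    unfolding c_def[abs_def]
    using has_vector_derivative_diff_const[THEN iffD2,
        OF has_vector_derivative_linear[OF linear_deviation derivative_\<Xi>[OF assms]]] .
  then have "(c has_vector_derivative q *\<^sub>R laplacian E (a t)) (at t within {0..})"
    by (simp add: linear_simps sym a_def)
  then have "(h has_vector_derivative q *\<^sub>R laplacian E (a t)
      + (q / p) *\<^sub>R (b t - p *\<^sub>R laplacian E (a t) - q *\<^sub>R laplacian E (c t))) (at t within {0..})"
    unfolding h_def[abs_def]
    by (intro has_vector_derivative_add derivative_a[OF assms]
        bounded_linear.has_vector_derivative[OF bounded_linear_scaleR_right])
  then show ?thesis using pos by (simp add: algebra_simps)
qed

definition "V t = F (mean (W t)) - F w_opt + (norm (sqrt \<alpha> *\<^sub>R x t + v t))\<^sup>2 / 2"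
definition "U t = V t + \<beta> * (norm (b t))\<^sup>2 + (norm (h t))\<^sup>2 + \<mu> * (norm (a t))\<^sup>2"
definition "rate = min (sqrt \<alpha> - 2 * \<upsilon>) (q\<^sup>2 / p * \<nu> / 2)"

lemma suboptimality_bound: "(norm (x t))\<^sup>2 \<le> 2 / \<alpha> * (F (mean (W t)) - F w_opt)"
  using strongly_convex_tangent_bound[OF strongly_convex, of w_opt "mean (W t)"]
    gradient_at_minimum_eq_0[OF F_differentiable minimizer] pos
  by (simp add: x_def field_simps)

lemma V_bounds: "F (mean (W t)) - F w_opt \<le> V t" "(norm (sqrt \<alpha> *\<^sub>R x t + v t))\<^sup>2 \<le> 2 * V t" "0 \<le> V t"
proof -
  have "0 \<le> F (mean (W t)) - F w_opt"
    using minimizer by (auto simp: is_arg_min_def not_less)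
  moreover have "0 \<le> (norm (sqrt \<alpha> *\<^sub>R x t + v t))\<^sup>2" by simp
  ultimately show "F (mean (W t)) - F w_opt \<le> V t" "0 \<le> V t"
    "(norm (sqrt \<alpha> *\<^sub>R x t + v t))\<^sup>2 \<le> 2 * V t"
    by (simp_all add: V_def)
qed

lemma norm_e: "norm (e t) \<le> l * norm (a t)"
  using norm_mean_le[of "gradients f (W t) - gradients f (vec (mean (W t)))"]
    lipschitz[of "W t" "vec (mean (W t))"]
  by (simp add: e_def a_def deviation_def)

text \<open>
  The squared distances to rest split into a disagreement and an averaged part by orthogonality.
\<close>
lemma norm_W_diff: "(norm (W t - vec w_opt))\<^sup>2 = (norm (a t))\<^sup>2 + real CARD('m) * (norm (x t))\<^sup>2"
  using norm_squared_mean_deviation[of "W t - vec w_opt"]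
  by (simp add: linear_simps a_def x_def deviation_def linear_diff[OF linear_vec])

lemma norm_Z_diff: "(norm (Z t - z_opt))\<^sup>2 = (norm (b t))\<^sup>2 + real CARD('m) * (norm (v t))\<^sup>2"
  using norm_squared_mean_deviation[of "Z t - z_opt"]
  by (simp add: linear_simps b_def v_def mean_z_opt deviation_def linear_0[OF linear_vec] algebra_simps)

lemma V_dissipation:
  assumes "t \<ge> 0"
  obtains V' where "(V has_real_derivative V') (at t within {0..})"
    "V' \<le> - (sqrt \<alpha> - \<upsilon>) * V t + l\<^sup>2 / (2 * \<upsilon>) * (norm (a t))\<^sup>2"
proof -
  define V' where "V' = v t \<bullet> gradient F (mean (W t)) + (sqrt \<alpha> *\<^sub>R x t + v t) \<bullet>
      (sqrt \<alpha> *\<^sub>R v t + (- (2 * sqrt \<alpha>) *\<^sub>R v t - (gradient F (mean (W t)) + e t)))"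
  have "((\<lambda>s. mean (W s)) has_vector_derivative v t) (at t within {0..})"
    using derivative_x[OF assms] unfolding x_def[abs_def]
    by (simp only: has_vector_derivative_diff_const)
  note dF = has_real_derivative_along_curve[where u = "\<lambda>s. mean (W s)", OF F_differentiable this]
  have "((\<lambda>s. sqrt \<alpha> *\<^sub>R x s + v s) has_vector_derivative
      (sqrt \<alpha> *\<^sub>R v t + (- (2 * sqrt \<alpha>) *\<^sub>R v t - (gradient F (mean (W t)) + e t)))) (at t within {0..})"
    by (intro has_vector_derivative_add derivative_v[OF assms]
        bounded_linear.has_vector_derivative[OF bounded_linear_scaleR_right derivative_x[OF assms]])
  from DERIV_add[OF DERIV_diff[OF dF DERIV_const]
      DERIV_cdivide[OF has_real_derivative_norm_squared[OF this], of 2]]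
  have "(V has_real_derivative V') (at t within {0..})"
    unfolding V_def[abs_def] V'_def by simp
  moreover have "V' \<le> - (sqrt \<alpha> - \<upsilon>) * V t + (norm (e t))\<^sup>2 / (2 * \<upsilon>)"
    unfolding V'_def V_def x_def using pos
    by (intro heavy_ball_dissipation strongly_convex minimizer) auto
  moreover have "(norm (e t))\<^sup>2 / (2 * \<upsilon>) \<le> l\<^sup>2 / (2 * \<upsilon>) * (norm (a t))\<^sup>2"
    using power_mono[OF norm_e, of t 2] pos by (simp add: power_mult_distrib divide_right_mono)
  ultimately show ?thesis by (intro that) auto
qed

text \<open>
  The drift \<open>b\<close> is damped at twice the rate \<open>sqrt \<alpha>\<close> that is needed once it has paid for its input,
  the change of the gradients, which the disagreement and the averaged motion control.
\<close>
lemma b_dissipation: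
  "\<beta> * (2 * (b t \<bullet> (- (2 * sqrt \<alpha>) *\<^sub>R b t - deviation (g t))))
    \<le> - 2 * sqrt \<alpha> * \<beta> * (norm (b t))\<^sup>2 + \<beta> * l\<^sup>2 / (2 * sqrt \<alpha>) * (norm (a t))\<^sup>2 + \<upsilon> * V t"
proof -
  define s where "s = sqrt \<alpha>"
  have s: "s > 0" using pos by (simp add: s_def)
  have "norm (g t) \<le> l * norm (W t - vec w_opt)" unfolding g_def by (rule lipschitz)
  then have "(norm (g t))\<^sup>2 \<le> l\<^sup>2 * (norm (W t - vec w_opt))\<^sup>2"
    using power_mono[of "norm (g t)" "l * norm (W t - vec w_opt)" 2] by (simp add: power_mult_distrib)
  also have "\<dots> = l\<^sup>2 * (norm (a t))\<^sup>2 + l\<^sup>2 * real CARD('m) * (norm (x t))\<^sup>2"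
    by (simp add: norm_W_diff algebra_simps)
  also have "\<dots> \<le> l\<^sup>2 * (norm (a t))\<^sup>2 + l\<^sup>2 * real CARD('m) * (2 / \<alpha> * V t)"
  proof (intro add_left_mono mult_left_mono)
    have "2 / \<alpha> * (F (mean (W t)) - F w_opt) \<le> 2 / \<alpha> * V t"
      using V_bounds(1) pos by (intro mult_left_mono) auto
    with suboptimality_bound show "(norm (x t))\<^sup>2 \<le> 2 / \<alpha> * V t" by (rule order_trans)
  qed (use pos in auto)
  finally have "\<beta> / (2 * s) * (norm (g t))\<^sup>2
      \<le> \<beta> / (2 * s) * (l\<^sup>2 * (norm (a t))\<^sup>2 + l\<^sup>2 * real CARD('m) * (2 / \<alpha> * V t))"
    using \<beta>_pos s by (intro mult_left_mono) auto
  also have "\<dots> = \<beta> * l\<^sup>2 / (2 * s) * (norm (a t))\<^sup>2 + (\<beta> * (l\<^sup>2 * real CARD('m)) / (s * \<alpha>)) * V t"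
    using s pos by (simp add: field_simps)
  also have "\<beta> * (l\<^sup>2 * real CARD('m)) / (s * \<alpha>) = \<upsilon>"
    unfolding \<beta> s_def using pos by simp
  finally have G: "\<beta> / (2 * s) * (norm (g t))\<^sup>2 \<le> \<beta> * l\<^sup>2 / (2 * s) * (norm (a t))\<^sup>2 + \<upsilon> * V t" .
  have "- (b t \<bullet> g t) \<le> norm (b t) * norm (g t)"
    using Cauchy_Schwarz_ineq2[of "b t" "g t"] by linarith
  moreover have "2 * (norm (b t) * norm (g t)) \<le> 2 * s * (norm (b t))\<^sup>2 + (norm (g t))\<^sup>2 / (2 * s)"
    using young_inequality[of "2 * s" "norm (b t)" "norm (g t)"] s by simp
  ultimately have "2 * (b t \<bullet> (- (2 * s) *\<^sub>R b t - deviation (g t)))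
      \<le> - 2 * s * (norm (b t))\<^sup>2 + (norm (g t))\<^sup>2 / (2 * s)"
    by (simp add: inner_diff_right inner_deviation_right mean_eq_0 power2_norm_eq_inner)
  from mult_left_mono[OF this, of \<beta>]
  have "\<beta> * (2 * (b t \<bullet> (- (2 * s) *\<^sub>R b t - deviation (g t))))
      \<le> - 2 * s * \<beta> * (norm (b t))\<^sup>2 + \<beta> / (2 * s) * (norm (g t))\<^sup>2"
    using \<beta>_pos by (simp add: algebra_simps)
  with G show ?thesis unfolding s_def by linarith
qed

text \<open>
  Every term of \<open>U\<close> now decays at least at \<open>rate\<close>: the heavy ball energy at \<open>sqrt \<alpha>\<close> minus the
  two losses of \<open>\<upsilon>\<close>, the integral error at a multiple of \<open>q\<^sup>2 / p\<close>, and the other two at \<open>sqrt \<alpha>\<close>.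
\<close>
lemma U_dissipation:
  assumes "t \<ge> 0"
  shows "\<exists>U'. (U has_real_derivative U') (at t within {0..}) \<and> U' \<le> - rate * U t"
proof -
  obtain V' where V': "(V has_real_derivative V') (at t within {0..})"
    "V' \<le> - (sqrt \<alpha> - \<upsilon>) * V t + l\<^sup>2 / (2 * \<upsilon>) * (norm (a t))\<^sup>2"
    using V_dissipation[OF assms] .
  let ?B' = "\<beta> * (2 * (b t \<bullet> (- (2 * sqrt \<alpha>) *\<^sub>R b t - deviation (g t))))"
  let ?H' = "2 * (h t \<bullet> ((q / p) *\<^sub>R (b t - q *\<^sub>R laplacian E (c t))))"
  let ?A' = "\<mu> * (2 * (a t \<bullet> (b t - p *\<^sub>R laplacian E (a t) - q *\<^sub>R laplacian E (c t))))"
  let ?A = "(norm (a t))\<^sup>2" and ?B = "(norm (b t))\<^sup>2" and ?H = "(norm (h t))\<^sup>2"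
  have deriv: "(U has_real_derivative (V' + ?B' + ?H' + ?A')) (at t within {0..})"
    unfolding U_def[abs_def]
    by (intro DERIV_add V'(1) DERIV_cmult has_real_derivative_norm_squared
        derivative_a derivative_b derivative_h assms)
  have "?H' + ?A' \<le> - (q\<^sup>2 / p * \<nu> / 2) * ?H - (\<mu> * \<nu> * p / 2) * ?A + (2 * (1 + \<mu>) / (\<nu> * p)) * ?B"
    by (rule disagreement_dissipation[OF linear_laplacian pos(6,7,3,4) gap gap bound ratio h_def \<mu>])
      (simp_all add: mean_eq_0)
  moreover have "(2 * (1 + \<mu>) / (\<nu> * p)) * ?B \<le> sqrt \<alpha> * \<beta> * ?B"
    by (intro mult_right_mono large_p) simp
  moreover have "(l\<^sup>2 / (2 * \<upsilon>) + \<beta> * l\<^sup>2 / (2 * sqrt \<alpha>) + sqrt \<alpha> * \<mu>) * ?A \<le> (\<mu> * \<nu> * p / 2) * ?A"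
    by (intro mult_right_mono large_p) simp
  ultimately have "V' + ?B' + ?H' + ?A' \<le> - (sqrt \<alpha> - 2 * \<upsilon>) * V t - sqrt \<alpha> * (\<beta> * ?B)
      - (q\<^sup>2 / p * \<nu> / 2) * ?H - sqrt \<alpha> * (\<mu> * ?A)"
    using V'(2) b_dissipation[of t] by (simp add: algebra_simps)
  moreover have "rate * V t \<le> (sqrt \<alpha> - 2 * \<upsilon>) * V t"
    by (intro mult_right_mono V_bounds) (simp add: rate_def)
  moreover have "rate * (\<beta> * ?B) \<le> sqrt \<alpha> * (\<beta> * ?B)"
    using pos \<beta>_pos by (intro mult_right_mono) (auto simp: rate_def)
  moreover have "rate * ?H \<le> (q\<^sup>2 / p * \<nu> / 2) * ?H"
    by (intro mult_right_mono) (auto simp: rate_def)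
  moreover have "rate * (\<mu> * ?A) \<le> sqrt \<alpha> * (\<mu> * ?A)"
    using pos \<mu>_pos by (intro mult_right_mono) (auto simp: rate_def)
  ultimately have "V' + ?B' + ?H' + ?A' \<le> - rate * U t"
    unfolding U_def by (simp add: algebra_simps)
  with deriv show ?thesis by blast
qed

lemma U_decay:
  assumes "t \<ge> 0"
  shows "U t \<le> U 0 * exp (- rate * t)"
proof -
  obtain U' where "\<And>t. t \<ge> 0 \<Longrightarrow> (U has_real_derivative U' t) (at t within {0..})"
    "\<And>t. t \<ge> 0 \<Longrightarrow> U' t \<le> - rate * U t"
    using U_dissipation by metis
  then show ?thesis using assms by (rule exponential_decay)
qed

lemma error_le_U:
  "(norm (W t - vec w_opt))\<^sup>2 + (norm (Z t - z_opt))\<^sup>2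
    \<le> (1 / \<mu> + 1 / \<beta> + 2 * real CARD('m) / \<alpha> + 8 * real CARD('m)) * U t"
proof -
  have "0 \<le> \<beta> * (norm (b t))\<^sup>2" "0 \<le> \<mu> * (norm (a t))\<^sup>2" using \<beta>_pos \<mu>_pos by auto
  with V_bounds(3)[of t]
  have U: "V t \<le> U t" "\<beta> * (norm (b t))\<^sup>2 \<le> U t" "\<mu> * (norm (a t))\<^sup>2 \<le> U t"
    unfolding U_def using zero_le_power2[of "norm (h t)"] by - linarith+
  have A: "(norm (a t))\<^sup>2 \<le> 1 / \<mu> * U t" using U(3) \<mu>_pos by (simp add: field_simps)
  have B: "(norm (b t))\<^sup>2 \<le> 1 / \<beta> * U t" using U(2) \<beta>_pos by (simp add: field_simps)
  have "F (mean (W t)) - F w_opt \<le> U t" using V_bounds(1)[of t] U(1) by linarith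
  then have "2 / \<alpha> * (F (mean (W t)) - F w_opt) \<le> 2 / \<alpha> * U t"
    using pos by (intro mult_left_mono) auto
  with suboptimality_bound have X: "(norm (x t))\<^sup>2 \<le> 2 / \<alpha> * U t" by (rule order_trans)
  let ?y = "sqrt \<alpha> *\<^sub>R x t + v t"
  have "norm (v t) \<le> norm ?y + norm (sqrt \<alpha> *\<^sub>R x t)"
    using norm_triangle_ineq4[of ?y "sqrt \<alpha> *\<^sub>R x t"] by simp
  then have "(norm (v t))\<^sup>2 \<le> (norm ?y + norm (sqrt \<alpha> *\<^sub>R x t))\<^sup>2" by (intro power_mono) auto
  also have "\<dots> \<le> 2 * (norm ?y)\<^sup>2 + 2 * (norm (sqrt \<alpha> *\<^sub>R x t))\<^sup>2"
    using young_inequality[of 1 "norm ?y" "norm (sqrt \<alpha> *\<^sub>R x t)"] by (simp add: power2_sum)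
  also have "\<dots> \<le> 4 * U t + 4 * U t"
  proof (rule add_mono)
    show "2 * (norm ?y)\<^sup>2 \<le> 4 * U t" using V_bounds(2)[of t] U(1) by linarith
    have "\<alpha> * (norm (x t))\<^sup>2 \<le> 2 * U t" using X pos by (simp add: field_simps)
    then show "2 * (norm (sqrt \<alpha> *\<^sub>R x t))\<^sup>2 \<le> 4 * U t" using pos by (simp add: power_mult_distrib)
  qed
  finally have "real CARD('m) * (norm (v t))\<^sup>2 \<le> real CARD('m) * (8 * U t)" by (intro mult_left_mono) auto
  moreover have "real CARD('m) * (norm (x t))\<^sup>2 \<le> real CARD('m) * (2 / \<alpha> * U t)" using X by (intro mult_left_mono) auto
  moreover have "(1 / \<mu> + 1 / \<beta> + 2 * real CARD('m) / \<alpha> + 8 * real CARD('m)) * U t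
      = 1 / \<mu> * U t + 1 / \<beta> * U t + real CARD('m) * (2 / \<alpha> * U t) + real CARD('m) * (8 * U t)"
    by (simp add: algebra_simps)
  ultimately show ?thesis using A B unfolding norm_W_diff norm_Z_diff by linarith
qed

text \<open>
  The Lyapunov function dominates the squared error, so the error itself decays at half the rate.
\<close>
proposition trajectory_converges:
  assumes "\<upsilon> < sqrt \<alpha> / 2"
  shows "converges_exponentially (\<lambda>t. (w t i, z t i))
    (w_opt, - (1 / (2 * sqrt \<alpha>)) *\<^sub>R gradient (f i) w_opt)
    (min (sqrt \<alpha> / 2 - \<upsilon>) (q\<^sup>2 / p * \<nu> / 4))"
proof -
  define K where "K = 1 / \<mu> + 1 / \<beta> + 2 * real CARD('m) / \<alpha> + 8 * real CARD('m)"
  have K: "K \<ge> 0" unfolding K_def using \<mu>_pos \<beta>_pos pos by (intro add_nonneg_nonneg) auto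
  have rate: "min (sqrt \<alpha> / 2 - \<upsilon>) (q\<^sup>2 / p * \<nu> / 4) = rate / 2" by (simp add: rate_def min_def mult.commute)
  have "norm ((w t i, z t i) - (w_opt, - (1 / (2 * sqrt \<alpha>)) *\<^sub>R gradient (f i) w_opt))
      \<le> sqrt (K * U 0) * exp (- (rate / 2) * t)" if "t \<ge> 0" for t
  proof -
    have "norm (w t i - w_opt) \<le> norm (W t - vec w_opt)"
      using Finite_Cartesian_Product.norm_nth_le[of "W t - vec w_opt" i] by (simp add: W_def)
    moreover have "norm (z t i + (1 / (2 * sqrt \<alpha>)) *\<^sub>R gradient (f i) w_opt) \<le> norm (Z t - z_opt)"
      using Finite_Cartesian_Product.norm_nth_le[of "Z t - z_opt" i] by (simp add: Z_def z_opt_def gradients_def)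
    ultimately have "(norm (w t i - w_opt))\<^sup>2
        + (norm (z t i + (1 / (2 * sqrt \<alpha>)) *\<^sub>R gradient (f i) w_opt))\<^sup>2
        \<le> (norm (W t - vec w_opt))\<^sup>2 + (norm (Z t - z_opt))\<^sup>2"
      by (intro add_mono power_mono) auto
    also have "\<dots> \<le> K * U t" unfolding K_def by (rule error_le_U)
    also have "\<dots> \<le> K * (U 0 * exp (- rate * t))" by (intro mult_left_mono U_decay that K)
    also have "\<dots> = K * U 0 * (exp (- (rate / 2) * t))\<^sup>2"
      by (simp flip: exp_double)
    finally have "sqrt ((norm (w t i - w_opt))\<^sup>2
        + (norm (z t i + (1 / (2 * sqrt \<alpha>)) *\<^sub>R gradient (f i) w_opt))\<^sup>2)
        \<le> sqrt (K * U 0 * (exp (- (rate / 2) * t))\<^sup>2)" by (rule real_sqrt_le_mono)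
    then show ?thesis by (simp add: norm_Pair real_sqrt_mult)
  qed
  moreover have "rate > 0" using assms pos by (simp add: rate_def)
  ultimately show ?thesis unfolding converges_exponentially_def rate by auto
qed

end

section \<open>Convergence\<close>

text \<open>
  The thresholds depend on the problem and on \<open>\<upsilon>\<close> only, not on the gains, so that both \<open>p\<close> growing
  with \<open>q\<close> fixed and \<open>p = q powr (3/2)\<close> are covered. The loss of rate through slow integral
  action shows in \<open>q\<^sup>2 / p\<close>.
\<close>
lemma exponential_rate_bound:
  fixes f :: "'m::finite \<Rightarrow> 'a::euclidean_space \<Rightarrow> real"
  assumes "\<And>i x. f i differentiable (at x)"
    and "\<And>i. \<exists>L. L-lipschitz_on UNIV (gradient (f i))"
    and "\<alpha> > 0"
    and "strongly_convex \<alpha> (average f)"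
    and "is_arg_min (average f) (\<lambda>_. True) w_opt"
    and "sym E" and "E\<^sup>* = UNIV"
    and "0 < \<upsilon>" "\<upsilon> < sqrt \<alpha> / 2"
  shows "\<exists>P>0. \<exists>\<kappa>>0. \<exists>\<nu>>0. \<forall>p q w z \<xi> i.
    is_solution E f \<alpha> p q w z \<xi> \<longrightarrow> P \<le> p \<longrightarrow> 0 < q \<longrightarrow> q\<^sup>2 \<le> \<kappa> * p\<^sup>2 \<longrightarrow>
    converges_exponentially (\<lambda>t. (w t i, z t i))
      (w_opt, - (1 / (2 * sqrt \<alpha>)) *\<^sub>R gradient (f i) w_opt)
      (min (sqrt \<alpha> / 2 - \<upsilon>) (\<nu> * (q\<^sup>2 / p)))"
proof -
  obtain l where l: "l > 0" "\<And>u v. norm (gradients f u - gradients f v) \<le> l * norm (u - v)"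
    using lipschitz_gradients[of f, OF assms(2)] by blast
  obtain \<nu> where \<nu>: "\<nu> > 0" "\<And>u :: 'a ^ 'm. mean u = 0 \<Longrightarrow> \<nu> * (norm u)\<^sup>2 \<le> u \<bullet> laplacian E u"
    using spectral_gap[OF assms(6,7)] by blast
  have "bounded_linear (laplacian E :: 'a ^ 'm \<Rightarrow> 'a ^ 'm)"
    using linear_laplacian linear_conv_bounded_linear by blast
  then obtain B where B: "\<And>u :: 'a ^ 'm. norm (laplacian E u) \<le> norm u * B"
    using bounded_linear.bounded by blast
  define \<Lambda> where "\<Lambda> = max B \<nu>"
  have \<Lambda>: "\<nu> \<le> \<Lambda>" "\<And>u :: 'a ^ 'm. norm (laplacian E u) \<le> \<Lambda> * norm u"
  proof -
    fix u :: "'a ^ 'm"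
    have "norm u * B \<le> norm u * \<Lambda>" by (intro mult_left_mono) (auto simp: \<Lambda>_def)
    with B[of u] show "norm (laplacian E u) \<le> \<Lambda> * norm u" by (simp add: mult.commute)
  qed (simp add: \<Lambda>_def)
  define \<mu> where "\<mu> = \<nu>\<^sup>2 / (4 * \<Lambda>\<^sup>2)"
  define \<beta> where "\<beta> = \<upsilon> * \<alpha> * sqrt \<alpha> / (l\<^sup>2 * real CARD('m))"
  have pos: "\<Lambda> > 0" "\<mu> > 0" "\<beta> > 0"
    using \<nu>(1) \<Lambda>(1) l(1) assms by (auto simp: \<mu>_def \<beta>_def)
  define A where "A = l\<^sup>2 / (2 * \<upsilon>) + \<beta> * l\<^sup>2 / (2 * sqrt \<alpha>) + sqrt \<alpha> * \<mu>"
  define P where "P = max (2 * (1 + \<mu>) / (\<nu> * (sqrt \<alpha> * \<beta>))) (2 * A / (\<mu> * \<nu>))"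
  define \<kappa> where "\<kappa> = \<nu>\<^sup>2 / (8 * \<Lambda>\<^sup>2)"
  have "0 < 2 * (1 + \<mu>) / (\<nu> * (sqrt \<alpha> * \<beta>))" using pos \<nu>(1) assms(3) by simp
  then have "P > 0" unfolding P_def by (rule less_le_trans) simp
  have "\<kappa> > 0" using pos \<nu>(1) by (simp add: \<kappa>_def)
  show ?thesis
  proof (rule exI[of _ P], rule conjI[OF \<open>P > 0\<close>], rule exI[of _ \<kappa>], rule conjI[OF \<open>\<kappa> > 0\<close>],
      rule exI[of _ "\<nu> / 4"], intro conjI allI impI)
    fix p q w z \<xi> i
    assume H: "is_solution E f \<alpha> p q w z \<xi>" "P \<le> p" "q > 0" "q\<^sup>2 \<le> \<kappa> * p\<^sup>2"
    have "p > 0" using H(2) \<open>P > 0\<close> by linarith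
    have "2 * (1 + \<mu>) / (\<nu> * (sqrt \<alpha> * \<beta>)) \<le> p" "2 * A / (\<mu> * \<nu>) \<le> p"
      using H(2) by (auto simp: P_def)
    then have large: "2 * (1 + \<mu>) / (\<nu> * p) \<le> sqrt \<alpha> * \<beta>" "A \<le> \<mu> * \<nu> * p / 2"
      using \<open>p > 0\<close> pos \<nu>(1) assms(3) by (simp_all add: pos_divide_le_eq mult_ac)
    interpret consensus_trajectory f E \<alpha> \<nu> \<Lambda> l \<upsilon> \<mu> \<beta> p q w_opt w z \<xi>
    proof unfold_locales
      show "8 * \<Lambda>\<^sup>2 * q\<^sup>2 \<le> \<nu>\<^sup>2 * p\<^sup>2"
        using H(4) pos by (simp add: \<kappa>_def field_simps)
      show "l\<^sup>2 / (2 * \<upsilon>) + \<beta> * l\<^sup>2 / (2 * sqrt \<alpha>) + sqrt \<alpha> * \<mu> \<le> \<mu> * \<nu> * p / 2"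
        using large(2) by (simp add: A_def)
    qed (fact assms l \<nu> \<Lambda> \<mu>_def \<beta>_def large H \<open>p > 0\<close>)+
    show "converges_exponentially (\<lambda>t. (w t i, z t i))
        (w_opt, - (1 / (2 * sqrt \<alpha>)) *\<^sub>R gradient (f i) w_opt)
        (min (sqrt \<alpha> / 2 - \<upsilon>) (\<nu> / 4 * (q\<^sup>2 / p)))"
      using trajectory_converges[OF assms(9), of i] by (simp add: mult.commute)
  qed (use \<nu>(1) in simp)
qed

lemma converges_exponentially_tendsto:
  assumes "converges_exponentially p l r"
  shows "(p \<longlongrightarrow> l) at_top"
proof -
  obtain C where r: "r > 0" and C: "\<And>t. t \<ge> 0 \<Longrightarrow> norm (p t - l) \<le> C * exp (- r * t)"
    using assms unfolding converges_exponentially_def by blast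
  have "LIM t at_top. - (r * t) :> at_bot"
    using r by (intro filterlim_compose[OF filterlim_uminus_at_bot_at_top]
        filterlim_tendsto_pos_mult_at_top[OF tendsto_const] filterlim_ident)
  then have "((\<lambda>t. exp (- r * t)) \<longlongrightarrow> 0) at_top"
    using filterlim_compose[OF exp_at_bot] by simp
  then have "((\<lambda>t. C * exp (- r * t)) \<longlongrightarrow> 0) at_top" by (rule tendsto_mult_right_zero)
  moreover have "\<forall>\<^sub>F t in at_top. norm (p t - l) \<le> C * exp (- r * t)"
    using C by (auto intro: eventually_mono[OF eventually_ge_at_top[of 0]])
  ultimately have "((\<lambda>t. p t - l) \<longlongrightarrow> 0) at_top"
    by (rule Lim_null_comparison[rotated])
  then show ?thesis by (simp add: Lim_null[symmetric])
qed

theorem theorem5: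
  fixes f :: "'m::finite \<Rightarrow> real ^ 'n \<Rightarrow> real"
    and E :: "('m \<times> 'm) set"
    and \<alpha> :: real
    and w_opt :: "real ^ 'n"
  assumes "\<And>i. continuously_differentiable (f i)"
    and "\<And>i. \<exists>L. L-lipschitz_on UNIV (gradient (f i))"
    and "\<alpha> > 0"
    and "strongly_convex \<alpha> (average f)"
    and "is_arg_min (average f) (\<lambda>_. True) w_opt"
    and "sym E" and "irrefl E" and "E\<^sup>* = UNIV"
  shows "(\<forall>kI>0. \<exists>K>0. \<forall>kP>K. \<forall>w z \<xi>. is_solution E f \<alpha> kP kI w z \<xi> \<longrightarrow>
            (\<forall>i. ((\<lambda>t. w t i) \<longlongrightarrow> w_opt) at_top \<and>
                 ((\<lambda>t. z t i) \<longlongrightarrow> - (1 / (2 * sqrt \<alpha>)) *\<^sub>R gradient (f i) w_opt) at_top)) \<and>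
         (\<forall>\<upsilon>. 0 < \<upsilon> \<and> \<upsilon> < sqrt \<alpha> / 2 \<longrightarrow>
            (\<exists>K>0. \<forall>kI>K. \<forall>w z \<xi>. is_solution E f \<alpha> (kI powr (3/2)) kI w z \<xi> \<longrightarrow>
               (\<forall>i. converges_exponentially (\<lambda>t. (w t i, z t i))
                      (w_opt, - (1 / (2 * sqrt \<alpha>)) *\<^sub>R gradient (f i) w_opt)
                      (sqrt \<alpha> / 2 - \<upsilon>))))"
proof -
  have diff: "\<And>i x. f i differentiable (at x)"
    using assms(1) by (simp add: continuously_differentiable_def)
  note rate_bound = exponential_rate_bound[OF diff assms(2-6) assms(8)]
  show ?thesis
  proof (intro conjI[where Q = "\<forall>\<upsilon>. _ \<upsilon>"] allI impI)
    fix kI :: real assume "kI > 0"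
    \<comment> \<open>Here any positive rate will do; the loss of \<open>sqrt \<alpha> / 4\<close> is an arbitrary choice.\<close>
    have "0 < sqrt \<alpha> / 4" "sqrt \<alpha> / 4 < sqrt \<alpha> / 2" using assms(3) by auto
    from rate_bound[OF this] obtain P \<kappa> \<nu> where c: "P > 0" "\<kappa> > 0" "\<nu> > 0"
      and conv: "\<forall>p q w z \<xi> i.
        is_solution E f \<alpha> p q w z \<xi> \<longrightarrow> P \<le> p \<longrightarrow> 0 < q \<longrightarrow> q\<^sup>2 \<le> \<kappa> * p\<^sup>2 \<longrightarrow>
        converges_exponentially (\<lambda>t. (w t i, z t i))
          (w_opt, - (1 / (2 * sqrt \<alpha>)) *\<^sub>R gradient (f i) w_opt)
          (min (sqrt \<alpha> / 2 - sqrt \<alpha> / 4) (\<nu> * (q\<^sup>2 / p)))"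
      by (elim exE conjE)
    show "\<exists>K>0. \<forall>kP>K. \<forall>w z \<xi>. is_solution E f \<alpha> kP kI w z \<xi> \<longrightarrow>
            (\<forall>i. ((\<lambda>t. w t i) \<longlongrightarrow> w_opt) at_top \<and>
                 ((\<lambda>t. z t i) \<longlongrightarrow> - (1 / (2 * sqrt \<alpha>)) *\<^sub>R gradient (f i) w_opt) at_top)"
    proof (intro exI[of _ "max P (kI / sqrt \<kappa>)"] conjI[where P = "0 < _"] allI impI)
      fix kP w z \<xi> i
      assume kP: "kP > max P (kI / sqrt \<kappa>)" and sol: "is_solution E f \<alpha> kP kI w z \<xi>"
      have "kI \<le> sqrt \<kappa> * kP" using kP c by (simp add: field_simps)
      then have "kI\<^sup>2 \<le> (sqrt \<kappa> * kP)\<^sup>2" using \<open>kI > 0\<close> by (intro power_mono) auto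
      then have "kI\<^sup>2 \<le> \<kappa> * kP\<^sup>2" using c by (simp add: power_mult_distrib)
      with conv[rule_format, OF sol _ \<open>kI > 0\<close>, of i] kP
      have lim: "((\<lambda>t. (w t i, z t i))
          \<longlongrightarrow> (w_opt, - (1 / (2 * sqrt \<alpha>)) *\<^sub>R gradient (f i) w_opt)) at_top"
        by (intro converges_exponentially_tendsto) auto
      show "((\<lambda>t. w t i) \<longlongrightarrow> w_opt) at_top \<and>
          ((\<lambda>t. z t i) \<longlongrightarrow> - (1 / (2 * sqrt \<alpha>)) *\<^sub>R gradient (f i) w_opt) at_top"
        using tendsto_fst[OF lim] tendsto_snd[OF lim] by simp
    qed (use c in simp)
  next
    fix \<upsilon> assume \<upsilon>: "0 < \<upsilon> \<and> \<upsilon> < sqrt \<alpha> / 2"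
    from rate_bound[OF conjunct1[OF this] conjunct2[OF this]]
    obtain P \<kappa> \<nu> where c: "P > 0" "\<kappa> > 0" "\<nu> > 0"
      and conv: "\<forall>p q w z \<xi> i.
        is_solution E f \<alpha> p q w z \<xi> \<longrightarrow> P \<le> p \<longrightarrow> 0 < q \<longrightarrow> q\<^sup>2 \<le> \<kappa> * p\<^sup>2 \<longrightarrow>
        converges_exponentially (\<lambda>t. (w t i, z t i))
          (w_opt, - (1 / (2 * sqrt \<alpha>)) *\<^sub>R gradient (f i) w_opt)
          (min (sqrt \<alpha> / 2 - \<upsilon>) (\<nu> * (q\<^sup>2 / p)))"
      by (elim exE conjE)
    \<comment> \<open>With \<open>kP = kI powr (3/2)\<close>, the square of \<open>kI / kP\<close> is \<open>1 / kI\<close> and \<open>kI\<^sup>2 / kP\<close> is \<open>sqrt kI\<close>: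
      the first becomes small enough for stability, the second large enough not to limit the rate.\<close>
    define K where "K = max (max 1 P) (max (1 / \<kappa>) ((sqrt \<alpha> / \<nu>)\<^sup>2))"
    have "K > 0" by (simp add: K_def)
    show "\<exists>K>0. \<forall>kI>K. \<forall>w z \<xi>. is_solution E f \<alpha> (kI powr (3/2)) kI w z \<xi> \<longrightarrow>
               (\<forall>i. converges_exponentially (\<lambda>t. (w t i, z t i))
                      (w_opt, - (1 / (2 * sqrt \<alpha>)) *\<^sub>R gradient (f i) w_opt)
                      (sqrt \<alpha> / 2 - \<upsilon>))"
    proof (intro exI[of _ K] conjI \<open>K > 0\<close> allI impI)
      fix kI w z \<xi> i
      assume "K < kI" and sol: "is_solution E f \<alpha> (kI powr (3/2)) kI w z \<xi>"
      then have kI: "1 < kI" "P < kI" "1 / \<kappa> < kI" "(sqrt \<alpha> / \<nu>)\<^sup>2 < kI" by (auto simp: K_def)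
      define kP where "kP = kI powr (3/2)"
      have "kI powr 1 \<le> kP" unfolding kP_def using kI by (intro powr_mono) auto
      then have "kP \<ge> P" using kI by simp
      have "kP\<^sup>2 = kI powr (3/2 + 3/2)" unfolding kP_def power2_eq_square by (rule powr_add[symmetric])
      also have "\<dots> = kI ^ 3" using kI by (simp add: powr_numeral)
      finally have kP2: "kP\<^sup>2 = kI ^ 3" .
      have "1 \<le> \<kappa> * kI" using kI c by (simp add: field_simps)
      then have "1 * kI\<^sup>2 \<le> \<kappa> * kI * kI\<^sup>2" using kI by (intro mult_right_mono) auto
      then have ratio: "kI\<^sup>2 \<le> \<kappa> * kP\<^sup>2" unfolding kP2 by (simp add: power2_eq_square power3_eq_cube mult_ac)
      have "kI\<^sup>2 / kP = kI powr 2 / kI powr (3/2)" using kI by (simp add: kP_def powr_numeral)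
      also have "\<dots> = kI powr (2 - 3/2)" by (rule powr_diff[symmetric])
      also have "\<dots> = sqrt kI" using kI by (simp add: powr_half_sqrt)
      finally have "kI\<^sup>2 / kP = sqrt kI" .
      moreover have "sqrt \<alpha> / \<nu> \<le> sqrt kI" using kI(4) by (intro real_le_rsqrt) simp
      ultimately have "sqrt \<alpha> / 2 - \<upsilon> \<le> \<nu> * (kI\<^sup>2 / kP)"
        using c(3) \<upsilon> assms(3) by (simp add: field_simps)
      with conv[rule_format, OF sol[folded kP_def] \<open>kP \<ge> P\<close> _ ratio, of i] kI
      show "converges_exponentially (\<lambda>t. (w t i, z t i))
          (w_opt, - (1 / (2 * sqrt \<alpha>)) *\<^sub>R gradient (f i) w_opt) (sqrt \<alpha> / 2 - \<upsilon>)"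
        by (simp add: min_absorb1)
    qed
  qed
qed

end
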